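(* In the setting described in the context, with POD space $X=L^2(\Omega)$, there is a constant $C>0$, not depending on any discretization parameter (i.e. not on $V^h$, $N$, $\Delta t$ or $r$), such that the errors $e^k=u^k-u_r^k$, $k=1,\dots,N$, between the backward Euler finite element solution and the BE-POD-ROM solution satisfy $$\max_{1\le k\le N}\|e^k\|_{L^2}^2\le C\left(\sum_{i=r+1}^s\lambda_i^{DQ1}\|\varphi_i-R_r\varphi_i\|_{L^2}^2+\|\phi_r^1\|_{L^2}^2\right).$$
   Context: All function spaces are real. $\Omega\subset\mathbb{R}^d$ ($d\ge1$) is an open bounded domain with Lipschitz continuous boundary, $V=H_0^1(\Omega)$ with inner product $(g,h)_{H_0^1}=(\nabla g,\nabla h)_{L^2}$, $\nu>0$ is a constant, $T>0$ is fixed, $N\ge2$, $\Delta t=T/(N-1)$, $t_n=(n-1)\Delta t$, and $f$ is a given forcing function, with $f^n=f(t_n)$. $V^h\subset V$ is a standard conforming (finite-dimensional) finite element space. Backward Euler finite element solution: $\{u^n\}_{n=1}^N\subset V^h$, with $u^1$ the given initial condition and, for $n=1,\dots,N-1$, $$\Big(\tfrac{u^{n+1}-u^n}{\Delta t},v\Big)_{L^2}+\nu(\nabla u^{n+1},\nabla v)_{L^2}=(f^{n+1},v)_{L^2}\quad\forall v\in V^h.$$ POD modes: write $\partial z^n=(z^{n+1}-z^n)/\Delta t$. Let $S=\mathbb{R}^N$ with inner product $(g,h)_S=g^1h^1+\Delta t\sum_{j=2}^Ng^jh^j$, and $K_1:S\to X$, $K_1f=f^1u^1+\sum_{j=1}^{N-1}\Delta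 t f^{j+1}\partial u^j$. Its singular value decomposition has singular values $(\lambda_i^{DQ1})^{1/2}$ (nonincreasing) and orthonormal singular vectors $f_i\in S$, $\varphi_i\in X$, with $K_1f_i=(\lambda_i^{DQ1})^{1/2}\varphi_i$. The $\varphi_i$ are the POD modes, the $\lambda_i^{DQ1}$ the POD eigenvalues, and $s$ is the number of positive POD eigenvalues. $r$ is a positive integer with $\varphi_1,\dots,\varphi_r\in V^h$, and $V_r^h=\mathrm{span}\{\varphi_j\}_{j=1}^r\subset V^h$. $\Pi_r^X:X\to X$ is the orthogonal projection onto $V_r^h$. BE-POD-ROM: $\{u_r^n\}_{n=1}^N\subset V_r^h$ with $u_r^1=\Pi_r^Xu^1$ and, for $n=1,\dots,N-1$, $$\Big(\tfrac{u_r^{n+1}-u_r^n}{\Delta t},v_r\Big)_{L^2}+\nu(\nabla u_r^{n+1},\nabla v_r)_{L^2}=(f^{n+1},v_r)_{L^2}\quad\forall v_r\in V_r^h.$$ The Ritz projection $R_r:V\to V_r^h$ is defined by $(\nabla(w-R_rw),\nabla v_r)_{L^2}=0$ for all $v_r\in V_r^h$. Finally $\phi_r^n=u_r^n-R_ru^n$ (distinct from the POD modes $\varphi_i$). *)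

theory Defs
  imports "HOL-Analysis.Analysis"
begin

section \<open>Bounded Lipschitz domains\<close>

text \<open>
  Near each boundary point, after a rotation taking the unit vector \<open>e\<close> to the last coordinate
  direction, the set is the strict subgraph of a Lipschitz function \<open>\<gamma>\<close> defined on the hyperplane
  orthogonal to \<open>e\<close>.
\<close>

definition lipschitz_boundary :: "(real ^ 'd) set \<Rightarrow> bool" where
  "lipschitz_boundary \<Omega> \<longleftrightarrow>
    (\<forall>p \<in> frontier \<Omega>. \<exists>\<rho> > 0. \<exists>e \<gamma> L. norm e = 1 \<and> L-lipschitz_on {y. y \<bullet> e = 0} \<gamma> \<and>
      (\<forall>x \<in> ball p \<rho>. x \<in> \<Omega> \<longleftrightarrow> x \<bullet> e < \<gamma> (x - (x \<bullet> e) *\<^sub>R e)))"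

definition bounded_lipschitz_domain :: "(real ^ 'd) set \<Rightarrow> bool" where
  "bounded_lipschitz_domain \<Omega> \<longleftrightarrow>
    open \<Omega> \<and> connected \<Omega> \<and> \<Omega> \<noteq> {} \<and> bounded \<Omega> \<and> lipschitz_boundary \<Omega>"

section \<open>Function spaces\<close>

text \<open>
  Elements of \<open>L\<^sup>2(\<Omega>)\<close> are represented by functions on the whole space, of which only the
  almost-everywhere class on \<open>\<Omega>\<close> matters; equality of elements is written as \<open>AE\<close>-equality with
  respect to Lebesgue measure on \<open>\<Omega>\<close>. The spaces \<open>L2\<close>, \<open>H1\<close>, \<open>H10\<close> and \<open>fun_span\<close> are closed under it.
\<close>

definition L2 :: "(real ^ 'd) set \<Rightarrow> (real ^ 'd \<Rightarrow> real) set" where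
  "L2 \<Omega> = {u \<in> borel_measurable (lebesgue_on \<Omega>). integrable (lebesgue_on \<Omega>) (\<lambda>x. (u x)\<^sup>2)}"

definition L2_inner :: "(real ^ 'd) set \<Rightarrow> (real ^ 'd \<Rightarrow> real) \<Rightarrow> (real ^ 'd \<Rightarrow> real) \<Rightarrow> real" where
  "L2_inner \<Omega> u v = (LINT x|lebesgue_on \<Omega>. u x * v x)"

definition L2_norm :: "(real ^ 'd) set \<Rightarrow> (real ^ 'd \<Rightarrow> real) \<Rightarrow> real" where
  "L2_norm \<Omega> u = sqrt (L2_inner \<Omega> u u)"

definition partial_deriv :: "'d \<Rightarrow> (real ^ 'd \<Rightarrow> real) \<Rightarrow> (real ^ 'd \<Rightarrow> real)" where
  "partial_deriv i \<psi> = (\<lambda>x. frechet_derivative \<psi> (at x) (axis i 1))"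

definition smooth :: "(real ^ 'd \<Rightarrow> real) \<Rightarrow> bool" where
  "smooth \<psi> \<longleftrightarrow> (\<forall>is x. foldr partial_deriv is \<psi> differentiable (at x))"

definition test_functions :: "(real ^ 'd) set \<Rightarrow> (real ^ 'd \<Rightarrow> real) set" where
  "test_functions \<Omega> =
    {\<psi>. smooth \<psi> \<and> compact (closure {x. \<psi> x \<noteq> 0}) \<and> closure {x. \<psi> x \<noteq> 0} \<subseteq> \<Omega>}"

definition has_weak_gradient ::
    "(real ^ 'd) set \<Rightarrow> (real ^ 'd \<Rightarrow> real) \<Rightarrow> (real ^ 'd \<Rightarrow> real ^ 'd) \<Rightarrow> bool" where
  "has_weak_gradient \<Omega> u g \<longleftrightarrow>
    (\<forall>i. (\<lambda>x. g x $ i) \<in> L2 \<Omega>) \<and>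
    (\<forall>\<psi> \<in> test_functions \<Omega>. \<forall>i.
      L2_inner \<Omega> u (partial_deriv i \<psi>) = - L2_inner \<Omega> (\<lambda>x. g x $ i) \<psi>)"

definition H1 :: "(real ^ 'd) set \<Rightarrow> (real ^ 'd \<Rightarrow> real) set" where
  "H1 \<Omega> = {u \<in> L2 \<Omega>. \<exists>g. has_weak_gradient \<Omega> u g}"

text \<open>The choice is unique up to null sets.\<close>

definition grad :: "(real ^ 'd) set \<Rightarrow> (real ^ 'd \<Rightarrow> real) \<Rightarrow> (real ^ 'd \<Rightarrow> real ^ 'd)" where
  "grad \<Omega> u = (SOME g. has_weak_gradient \<Omega> u g)"

definition grad_inner :: "(real ^ 'd) set \<Rightarrow> (real ^ 'd \<Rightarrow> real) \<Rightarrow> (real ^ 'd \<Rightarrow> real) \<Rightarrow> real" where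
  "grad_inner \<Omega> u v = (LINT x|lebesgue_on \<Omega>. grad \<Omega> u x \<bullet> grad \<Omega> v x)"

text \<open>
  \<open>H\<^sub>0\<^sup>1(\<Omega>)\<close> is the closure of the test functions in \<open>H\<^sup>1(\<Omega>)\<close>; the gradient of a test function is
  its classical gradient.
\<close>

definition H10 :: "(real ^ 'd) set \<Rightarrow> (real ^ 'd \<Rightarrow> real) set" where
  "H10 \<Omega> = {u \<in> H1 \<Omega>. \<exists>\<psi> :: nat \<Rightarrow> real ^ 'd \<Rightarrow> real. (\<forall>k. \<psi> k \<in> test_functions \<Omega>) \<and>
    (\<lambda>k. (LINT x|lebesgue_on \<Omega>. (u x - \<psi> k x)\<^sup>2) +
         (LINT x|lebesgue_on \<Omega>. (norm (grad \<Omega> u x - (\<chi> i. partial_deriv i (\<psi> k) x)))\<^sup>2))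
      \<longlonglongrightarrow> 0}"

section \<open>Finite-dimensional subspaces and projections\<close>

definition fun_span ::
    "(real ^ 'd) set \<Rightarrow> nat set \<Rightarrow> (nat \<Rightarrow> real ^ 'd \<Rightarrow> real) \<Rightarrow> (real ^ 'd \<Rightarrow> real) set" where
  "fun_span \<Omega> I b =
    {w \<in> L2 \<Omega>. \<exists>c. AE x in lebesgue_on \<Omega>. w x = (\<Sum>i\<in>I. c i * b i x)}"

definition conforming_space :: "(real ^ 'd) set \<Rightarrow> (real ^ 'd \<Rightarrow> real) set \<Rightarrow> bool" where
  "conforming_space \<Omega> W \<longleftrightarrow>
    (\<exists>m b. (\<forall>j \<in> {1..m}. b j \<in> H10 \<Omega>) \<and> W = fun_span \<Omega> {1..m} b)"

definition is_L2_projection ::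
    "(real ^ 'd) set \<Rightarrow> (real ^ 'd \<Rightarrow> real) set \<Rightarrow>
      (real ^ 'd \<Rightarrow> real) \<Rightarrow> (real ^ 'd \<Rightarrow> real) \<Rightarrow> bool" where
  "is_L2_projection \<Omega> W w p \<longleftrightarrow>
    p \<in> W \<and> (\<forall>v \<in> W. L2_inner \<Omega> (\<lambda>x. w x - p x) v = 0)"

definition is_ritz_projection ::
    "(real ^ 'd) set \<Rightarrow> (real ^ 'd \<Rightarrow> real) set \<Rightarrow>
      ((real ^ 'd \<Rightarrow> real) \<Rightarrow> (real ^ 'd \<Rightarrow> real)) \<Rightarrow> bool" where
  "is_ritz_projection \<Omega> W R \<longleftrightarrow>
    (\<forall>w \<in> H10 \<Omega>. R w \<in> W \<and> (\<forall>v \<in> W. grad_inner \<Omega> (\<lambda>x. w x - R w x) v = 0))"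

section \<open>Backward Euler\<close>

definition time_step :: "real \<Rightarrow> nat \<Rightarrow> real" where
  "time_step T N = T / (real N - 1)"

definition grid_time :: "real \<Rightarrow> nat \<Rightarrow> nat \<Rightarrow> real" where
  "grid_time T N n = (real n - 1) * time_step T N"

definition diff_quot ::
    "real \<Rightarrow> nat \<Rightarrow> (nat \<Rightarrow> real ^ 'd \<Rightarrow> real) \<Rightarrow> nat \<Rightarrow> (real ^ 'd \<Rightarrow> real)" where
  "diff_quot T N z n = (\<lambda>x. (z (n + 1) x - z n x) / time_step T N)"

text \<open>
  The scheme over a trial and test space \<open>W\<close>; the value \<open>w 1\<close> is left free, and only the values
  \<open>w 1, \<dots>, w N\<close> are relevant.
\<close>

definition backward_euler ::
    "(real ^ 'd) set \<Rightarrow> real \<Rightarrow> real \<Rightarrow> (real \<Rightarrow> real ^ 'd \<Rightarrow> real) \<Rightarrow> nat \<Rightarrow>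
      (real ^ 'd \<Rightarrow> real) set \<Rightarrow> (nat \<Rightarrow> real ^ 'd \<Rightarrow> real) \<Rightarrow> bool" where
  "backward_euler \<Omega> \<nu> T f N W w \<longleftrightarrow>
    (\<forall>n \<in> {1..N}. w n \<in> W) \<and>
    (\<forall>n \<in> {1..<N}. \<forall>v \<in> W.
      L2_inner \<Omega> (diff_quot T N w n) v + \<nu> * grad_inner \<Omega> (w (n + 1)) v
        = L2_inner \<Omega> (f (grid_time T N (n + 1))) v)"

section \<open>POD modes and eigenvalues\<close>

text \<open>Vectors in \<open>S = \<real>\<^sup>N\<close> are functions on \<open>nat\<close> of which only the values at \<open>1, \<dots>, N\<close> are used.\<close>

definition S_inner :: "real \<Rightarrow> nat \<Rightarrow> (nat \<Rightarrow> real) \<Rightarrow> (nat \<Rightarrow> real) \<Rightarrow> real" where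
  "S_inner T N g h = g 1 * h 1 + time_step T N * (\<Sum>j = 2..N. g j * h j)"

definition K1 ::
    "real \<Rightarrow> nat \<Rightarrow> (nat \<Rightarrow> real ^ 'd \<Rightarrow> real) \<Rightarrow> (nat \<Rightarrow> real) \<Rightarrow> (real ^ 'd \<Rightarrow> real)" where
  "K1 T N u g =
    (\<lambda>x. g 1 * u 1 x + (\<Sum>j = 1..<N. time_step T N * g (j + 1) * diff_quot T N u j x))"

text \<open>
  Singular value decomposition of \<open>K1\<close> as an operator from \<open>S\<close> to \<open>L\<^sup>2(\<Omega>)\<close>, in the full form:
  the right singular vectors \<open>F 1, \<dots>, F N\<close> are an orthonormal basis of \<open>S\<close>, and the left singular
  vectors \<open>\<phi> 1, \<phi> 2, \<dots>\<close> are an infinite orthonormal sequence, with singular value zero beyond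
  index \<open>N\<close>. Index \<open>0\<close> is not used.
\<close>

definition is_pod_svd ::
    "(real ^ 'd) set \<Rightarrow> real \<Rightarrow> nat \<Rightarrow> (nat \<Rightarrow> real ^ 'd \<Rightarrow> real) \<Rightarrow>
      (nat \<Rightarrow> real) \<Rightarrow> (nat \<Rightarrow> nat \<Rightarrow> real) \<Rightarrow> (nat \<Rightarrow> real ^ 'd \<Rightarrow> real) \<Rightarrow> bool" where
  "is_pod_svd \<Omega> T N u ev F \<phi> \<longleftrightarrow>
    (\<forall>i \<ge> 1. 0 \<le> ev i) \<and> (\<forall>i \<ge> 1. \<forall>j \<ge> i. ev j \<le> ev i) \<and> (\<forall>i > N. ev i = 0) \<and>
    (\<forall>i \<in> {1..N}. \<forall>j \<in> {1..N}. S_inner T N (F i) (F j) = (if i = j then 1 else 0)) \<and>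
    (\<forall>i \<ge> 1. \<phi> i \<in> L2 \<Omega>) \<and>
    (\<forall>i \<ge> 1. \<forall>j \<ge> 1. L2_inner \<Omega> (\<phi> i) (\<phi> j) = (if i = j then 1 else 0)) \<and>
    (\<forall>i \<in> {1..N}. AE x in lebesgue_on \<Omega>. K1 T N u (F i) x = sqrt (ev i) * \<phi> i x)"

definition num_positive :: "(nat \<Rightarrow> real) \<Rightarrow> nat" where
  "num_positive ev = card {i. i \<ge> 1 \<and> ev i > 0}"

end

theory Submission
  imports Defs
begin

text \<open>
  Split the error as \<open>e\<^sup>n = u\<^sup>n - u\<^sub>r\<^sup>n = \<eta>\<^sup>n - \<theta>\<^sup>n\<close> with the Ritz residual
  \<open>\<eta>\<^sup>n = u\<^sup>n - R u\<^sup>n\<close> and the discrete part \<open>\<theta>\<^sup>n = u\<^sub>r\<^sup>n - R u\<^sup>n\<close>. Subtracting the two schemes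
  and testing with \<open>\<theta>\<^bsup>n+1\<^esup>\<close>, which is admissible in both because \<open>V\<^sub>r\<^sup>h \<subseteq> V\<^sup>h\<close>, the Ritz
  projection removes \<open>\<eta>\<close> from the diffusion term, and the diffusion term that is left has a good
  sign. Hence \<open>\<parallel>\<theta>\<^bsup>n+1\<^esup>\<parallel> \<le> \<parallel>\<theta>\<^sup>n\<parallel> + \<Delta>t \<parallel>\<partial>\<eta>\<^sup>n\<parallel>\<close> (\<open>rom_error_step\<close>); the same recursion for
  \<open>\<parallel>\<eta>\<^sup>n\<parallel>\<close> is the triangle inequality (\<open>residual_growth_step\<close>). Since there are \<open>N - 1\<close> steps of
  length \<open>\<Delta>t\<close>, the Cauchy--Schwarz inequality gives
  \<open>(\<Delta>t \<Sum> \<parallel>\<partial>\<eta>\<^sup>n\<parallel>)\<^sup>2 \<le> T \<Delta>t \<Sum> \<parallel>\<partial>\<eta>\<^sup>n\<parallel>\<^sup>2\<close>, so everything is controlled by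
  \<open>\<parallel>\<theta>\<^sup>1\<parallel>\<close>, \<open>\<parallel>\<eta>\<^sup>1\<parallel>\<close> and \<open>\<Delta>t \<Sum> \<parallel>\<partial>\<eta>\<^sup>n\<parallel>\<^sup>2\<close>.

  The POD enters through an exact identity (\<open>pod_residual_identity\<close>):
  \<open>\<parallel>\<eta>\<^sup>1\<parallel>\<^sup>2 + \<Delta>t \<Sum> \<parallel>\<partial>\<eta>\<^sup>n\<parallel>\<^sup>2 = \<Sum>\<^sub>i \<lambda>\<^sub>i \<parallel>\<phi>\<^sub>i - R \<phi>\<^sub>i\<parallel>\<^sup>2\<close>. Indeed the right singular vectors form an
  orthonormal basis of \<open>S\<close>, so \<open>u\<^sup>1\<close> and the difference quotients \<open>\<partial>u\<^sup>n\<close> are the combinations of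
  the modes with coefficients \<open>\<surd>\<lambda>\<^sub>i F\<^sub>i\<^sup>j\<close> (\<open>snapshot_pod_expansion\<close>). The linear map \<open>w \<mapsto> w - R w\<close>
  turns these into the same combinations of the residuals \<open>\<phi>\<^sub>i - R \<phi>\<^sub>i\<close>, and orthonormality of
  the \<open>F\<^sub>i\<close> removes the cross terms. The first \<open>r\<close> modes lie in \<open>V\<^sub>r\<^sup>h\<close> and contribute nothing.
  The constant obtained is \<open>C = 3 (1 + 4 T)\<close>.

  What makes \<open>w \<mapsto> w - R w\<close> linear, as a map of almost-everywhere classes, is that \<open>H\<^sub>0\<^sup>1\<close> is a vector
  space on which \<open>(\<nabla>\<cdot>, \<nabla>\<cdot>)\<close> is bilinear and definite. Bilinearity and closure under sums need
  uniqueness of weak gradients, hence that only \<open>0\<close> is orthogonal to all test functions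
  (\<open>AE_0_if_orthogonal_to_test_functions\<close>); this is obtained from explicit smooth bumps that converge
  to indicator functions of boxes. Definiteness (\<open>H10_eq_0_if_gradient_eq_0\<close>) follows from testing the
  weak gradient with \<open>x\<^sub>i \<psi>\<close>, where \<open>\<psi>\<close> is a test function close to \<open>u\<close>.
\<close>

section \<open>Elementary properties of \<open>L\<^sup>2\<close>\<close>

lemma L2_borel: "u \<in> L2 \<Omega> \<Longrightarrow> u \<in> borel_measurable (lebesgue_on \<Omega>)"
  by (simp add: L2_def)

lemma L2_integrable_mult:
  assumes "u \<in> L2 \<Omega>" "v \<in> L2 \<Omega>"
  shows "integrable (lebesgue_on \<Omega>) (\<lambda>x. u x * v x)"
proof (rule Bochner_Integration.integrable_bound)
  show "integrable (lebesgue_on \<Omega>) (\<lambda>x. (u x)\<^sup>2 + (v x)\<^sup>2)"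
    using assms by (simp add: L2_def)
  show "(\<lambda>x. u x * v x) \<in> borel_measurable (lebesgue_on \<Omega>)"
    using L2_borel[OF assms(1)] L2_borel[OF assms(2)] by measurable
  have "\<bar>u x * v x\<bar> \<le> (u x)\<^sup>2 + (v x)\<^sup>2" for x
  proof -
    have "0 \<le> (\<bar>u x\<bar> - \<bar>v x\<bar>)\<^sup>2 + (\<bar>u x\<bar>)\<^sup>2 + (\<bar>v x\<bar>)\<^sup>2" by simp
    then show ?thesis by (simp add: power2_diff abs_mult)
  qed
  then show "AE x in lebesgue_on \<Omega>. norm (u x * v x) \<le> norm ((u x)\<^sup>2 + (v x)\<^sup>2)"
    by simp
qed

lemma L2_lincomb:
  assumes "u \<in> L2 \<Omega>" "v \<in> L2 \<Omega>"
  shows "(\<lambda>x. u x + c * v x) \<in> L2 \<Omega>"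
proof -
  have "integrable (lebesgue_on \<Omega>) (\<lambda>x. (u x)\<^sup>2 + 2 * c * (u x * v x) + c\<^sup>2 * (v x)\<^sup>2)"
    using assms L2_integrable_mult[OF assms] by (simp add: L2_def)
  then have "integrable (lebesgue_on \<Omega>) (\<lambda>x. (u x + c * v x)\<^sup>2)"
    by (simp add: power2_sum algebra_simps)
  moreover have "(\<lambda>x. u x + c * v x) \<in> borel_measurable (lebesgue_on \<Omega>)"
    using L2_borel[OF assms(1)] L2_borel[OF assms(2)] by measurable
  ultimately show ?thesis by (simp add: L2_def)
qed

lemma L2_zero [simp]: "(\<lambda>x. 0) \<in> L2 \<Omega>"
  by (simp add: L2_def)

lemma L2_diff: "u \<in> L2 \<Omega> \<Longrightarrow> v \<in> L2 \<Omega> \<Longrightarrow> (\<lambda>x. u x - v x) \<in> L2 \<Omega>"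
  using L2_lincomb[of u \<Omega> v "-1"] by simp

lemma L2_scale: "v \<in> L2 \<Omega> \<Longrightarrow> (\<lambda>x. c * v x) \<in> L2 \<Omega>"
  using L2_lincomb[of "\<lambda>x. 0" \<Omega> v c] by simp

lemma L2_sum:
  "(\<And>i. i \<in> I \<Longrightarrow> v i \<in> L2 \<Omega>) \<Longrightarrow> (\<lambda>x. \<Sum>i\<in>I. c i * v i x) \<in> L2 \<Omega>"
proof (induction I rule: infinite_finite_induct)
  case (insert i I)
  then show ?case
    using L2_lincomb[of "\<lambda>x. \<Sum>i\<in>I. c i * v i x" \<Omega> "v i" "c i"] by (simp add: add.commute)
qed simp_all

lemma L2_inner_commute: "L2_inner \<Omega> u v = L2_inner \<Omega> v u"
  by (simp add: L2_inner_def mult.commute)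

lemma L2_inner_lincomb:
  assumes "u \<in> L2 \<Omega>" "v \<in> L2 \<Omega>" "w \<in> L2 \<Omega>"
  shows "L2_inner \<Omega> (\<lambda>x. u x + c * v x) w = L2_inner \<Omega> u w + c * L2_inner \<Omega> v w"
  using L2_integrable_mult[OF assms(1,3)] L2_integrable_mult[OF assms(2,3)]
  by (simp add: L2_inner_def distrib_right mult.assoc)

lemma L2_inner_diff:
  assumes "u \<in> L2 \<Omega>" "v \<in> L2 \<Omega>" "w \<in> L2 \<Omega>"
  shows "L2_inner \<Omega> (\<lambda>x. u x - v x) w = L2_inner \<Omega> u w - L2_inner \<Omega> v w"
  using L2_inner_lincomb[OF assms, of "-1"] by simp

lemma L2_inner_scale: "L2_inner \<Omega> (\<lambda>x. c * v x) w = c * L2_inner \<Omega> v w"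
  by (simp add: L2_inner_def mult.assoc)

lemma L2_inner_sum:
  assumes "w \<in> L2 \<Omega>"
  shows "(\<And>i. i \<in> I \<Longrightarrow> v i \<in> L2 \<Omega>) \<Longrightarrow>
    L2_inner \<Omega> (\<lambda>x. \<Sum>i\<in>I. c i * v i x) w = (\<Sum>i\<in>I. c i * L2_inner \<Omega> (v i) w)"
proof (induction I rule: infinite_finite_induct)
  case (insert i I)
  then show ?case
    using L2_inner_lincomb[OF L2_sum[of I v \<Omega> c], of "v i" w "c i"] assms
    by (simp add: add.commute)
qed (simp_all add: L2_inner_def)

lemma L2_inner_cong_AE:
  assumes "AE x in lebesgue_on \<Omega>. u x = u' x"
    and "u \<in> L2 \<Omega>" "u' \<in> L2 \<Omega>" "v \<in> L2 \<Omega>"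
  shows "L2_inner \<Omega> u v = L2_inner \<Omega> u' v"
  unfolding L2_inner_def
  by (rule integral_cong_AE) (use assms in \<open>auto simp: L2_def\<close>)

lemma L2_inner_self_nonneg: "0 \<le> L2_inner \<Omega> u u"
  by (simp add: L2_inner_def)

lemma L2_norm_nonneg [simp]: "0 \<le> L2_norm \<Omega> u"
  by (simp add: L2_norm_def L2_inner_self_nonneg)

lemma L2_norm_square: "(L2_norm \<Omega> u)\<^sup>2 = L2_inner \<Omega> u u"
  by (simp add: L2_norm_def L2_inner_self_nonneg)

lemma L2_inner_self_eq_0_iff:
  assumes "u \<in> L2 \<Omega>"
  shows "L2_inner \<Omega> u u = 0 \<longleftrightarrow> (AE x in lebesgue_on \<Omega>. u x = 0)"
  using integral_nonneg_eq_0_iff_AE[OF L2_integrable_mult[OF assms assms]]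
  by (simp add: L2_inner_def)

lemma L2_norm_cong_AE:
  assumes "AE x in lebesgue_on \<Omega>. u x = u' x" "u \<in> L2 \<Omega>" "u' \<in> L2 \<Omega>"
  shows "L2_norm \<Omega> u = L2_norm \<Omega> u'"
  unfolding L2_norm_def L2_inner_def
  by (rule arg_cong[where f = sqrt], rule integral_cong_AE)
     (use assms in \<open>auto simp: L2_def\<close>)

lemma L2_inner_le_norm:
  assumes "u \<in> L2 \<Omega>" "v \<in> L2 \<Omega>"
  shows "\<bar>L2_inner \<Omega> u v\<bar> \<le> L2_norm \<Omega> u * L2_norm \<Omega> v"
proof -
  let ?a = "L2_inner \<Omega> u u" and ?b = "L2_inner \<Omega> u v" and ?c = "L2_inner \<Omega> v v"
  have expand: "0 \<le> ?a + 2 * t * ?b + t\<^sup>2 * ?c" for t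
  proof -
    let ?w = "\<lambda>x. u x + t * v x"
    have w: "?w \<in> L2 \<Omega>" by (rule L2_lincomb[OF assms])
    have "L2_inner \<Omega> ?w ?w = L2_inner \<Omega> u ?w + t * L2_inner \<Omega> v ?w"
      by (rule L2_inner_lincomb[OF assms w])
    also have "L2_inner \<Omega> u ?w = ?a + t * ?b"
      using L2_inner_lincomb[OF assms assms(1), of t] by (simp add: L2_inner_commute)
    also have "L2_inner \<Omega> v ?w = ?b + t * ?c"
      using L2_inner_lincomb[OF assms assms(2), of t] by (simp add: L2_inner_commute)
    finally show ?thesis
      using L2_inner_self_nonneg[of \<Omega> ?w] by (simp add: algebra_simps power2_eq_square)
  qed
  have "?b\<^sup>2 \<le> ?a * ?c"
  proof (cases "?c = 0")
    case True
    have "?b = 0"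
    proof (rule ccontr)
      assume "?b \<noteq> 0"
      then show False
        \<comment> \<open>With \<open>v\<close> a null function the quadratic in \<open>t\<close> is affine; this \<open>t\<close> makes it equal to \<open>-1\<close>.\<close>
        using expand[of "- (?a + 1) / (2 * ?b)"] True by (simp add: field_simps)
    qed
    then show ?thesis using True by simp
  next
    case False
    then have "?c > 0" using L2_inner_self_nonneg[of \<Omega> v] by linarith
    then show ?thesis
      \<comment> \<open>The minimum of the quadratic.\<close>
      using expand[of "- ?b / ?c"] by (simp add: field_simps power2_eq_square)
  qed
  then have "\<bar>?b\<bar> \<le> sqrt (?a * ?c)"
    by (rule real_le_rsqrt[of "\<bar>?b\<bar>", simplified])
  then show ?thesis by (simp add: L2_norm_def real_sqrt_mult)
qed

lemma L2_norm_lincomb_le: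
  assumes "u \<in> L2 \<Omega>" "v \<in> L2 \<Omega>"
  shows "L2_norm \<Omega> (\<lambda>x. u x + c * v x) \<le> L2_norm \<Omega> u + \<bar>c\<bar> * L2_norm \<Omega> v"
proof (rule power2_le_imp_le)
  let ?w = "\<lambda>x. u x + c * v x"
  have "(L2_norm \<Omega> ?w)\<^sup>2 = L2_inner \<Omega> u ?w + c * L2_inner \<Omega> v ?w"
    using L2_inner_lincomb[OF assms L2_lincomb[OF assms]] by (simp add: L2_norm_square)
  also have "\<dots> = L2_inner \<Omega> u u + 2 * (c * L2_inner \<Omega> u v) + c\<^sup>2 * L2_inner \<Omega> v v"
    using L2_inner_lincomb[OF assms assms(1), of c] L2_inner_lincomb[OF assms assms(2), of c]
    by (simp add: L2_inner_commute algebra_simps power2_eq_square)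
  also have "c * L2_inner \<Omega> u v \<le> \<bar>c\<bar> * (L2_norm \<Omega> u * L2_norm \<Omega> v)"
  proof -
    have "c * L2_inner \<Omega> u v \<le> \<bar>c\<bar> * \<bar>L2_inner \<Omega> u v\<bar>" by (metis abs_ge_self abs_mult)
    also have "\<dots> \<le> \<bar>c\<bar> * (L2_norm \<Omega> u * L2_norm \<Omega> v)"
      by (intro mult_left_mono L2_inner_le_norm assms) simp
    finally show ?thesis .
  qed
  finally show "(L2_norm \<Omega> ?w)\<^sup>2 \<le> (L2_norm \<Omega> u + \<bar>c\<bar> * L2_norm \<Omega> v)\<^sup>2"
    by (simp add: L2_norm_square[symmetric] power2_sum power_mult_distrib algebra_simps)
qed simp

lemma L2_norm_diff_le:
  "u \<in> L2 \<Omega> \<Longrightarrow> v \<in> L2 \<Omega> \<Longrightarrow> L2_norm \<Omega> (\<lambda>x. u x - v x) \<le> L2_norm \<Omega> u + L2_norm \<Omega> v"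
  using L2_norm_lincomb_le[of u \<Omega> v "-1"] by simp

lemma L2_inner_tendsto:
  assumes "u \<in> L2 \<Omega>" "\<And>k::nat. v k \<in> L2 \<Omega>" "w \<in> L2 \<Omega>"
    and "(\<lambda>k. L2_norm \<Omega> (\<lambda>x. w x - v k x)) \<longlonglongrightarrow> 0"
  shows "(\<lambda>k. L2_inner \<Omega> (v k) u) \<longlonglongrightarrow> L2_inner \<Omega> w u"
proof -
  have "(\<lambda>k. L2_inner \<Omega> w u - L2_inner \<Omega> (v k) u) \<longlonglongrightarrow> 0"
  proof (rule Lim_null_comparison)
    show "\<forall>\<^sub>F k in sequentially. norm (L2_inner \<Omega> w u - L2_inner \<Omega> (v k) u)
        \<le> L2_norm \<Omega> (\<lambda>x. w x - v k x) * L2_norm \<Omega> u"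
      using L2_inner_le_norm[OF L2_diff[OF assms(3,2)] assms(1)]
        L2_inner_diff[OF assms(3,2,1)] by simp
    show "(\<lambda>k. L2_norm \<Omega> (\<lambda>x. w x - v k x) * L2_norm \<Omega> u) \<longlonglongrightarrow> 0"
      using tendsto_mult_right[OF assms(4), of "L2_norm \<Omega> u"] by simp
  qed
  from tendsto_diff[OF tendsto_const[of "L2_inner \<Omega> w u"] this] show ?thesis by simp
qed

lemma L2_times_bounded:
  assumes "v \<in> L2 \<Omega>" "m \<in> borel_measurable (lebesgue_on \<Omega>)"
    and "\<And>x. x \<in> \<Omega> \<Longrightarrow> \<bar>m x\<bar> \<le> B"
  shows "(\<lambda>x. m x * v x) \<in> L2 \<Omega>"
proof -
  have "integrable (lebesgue_on \<Omega>) (\<lambda>x. (m x * v x)\<^sup>2)"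
  proof (rule Bochner_Integration.integrable_bound)
    show "integrable (lebesgue_on \<Omega>) (\<lambda>x. B\<^sup>2 * (v x)\<^sup>2)"
      using assms by (simp add: L2_def)
    show "(\<lambda>x. (m x * v x)\<^sup>2) \<in> borel_measurable (lebesgue_on \<Omega>)"
      using L2_borel[OF assms(1)] assms(2) by measurable
    have "(m x)\<^sup>2 \<le> B\<^sup>2" if "x \<in> \<Omega>" for x
      using assms(3)[OF that] by (metis abs_ge_zero power2_abs power_mono)
    then show "AE x in lebesgue_on \<Omega>. norm ((m x * v x)\<^sup>2) \<le> norm (B\<^sup>2 * (v x)\<^sup>2)"
      by (intro AE_I2) (simp add: power_mult_distrib mult_right_mono)
  qed
  moreover have "(\<lambda>x. m x * v x) \<in> borel_measurable (lebesgue_on \<Omega>)"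
    using L2_borel[OF assms(1)] assms(2) by measurable
  ultimately show ?thesis by (simp add: L2_def)
qed

section \<open>Smooth functions and test functions\<close>

text \<open>
  Smoothness is a condition on all iterated partial derivatives, so it has to be proved for a whole
  class of functions closed under differentiation. Subalgebras are convenient: by the product rule it
  suffices to differentiate generators.
\<close>

inductive_set generated_algebra ::
    "(real ^ 'd \<Rightarrow> real) set \<Rightarrow> (real ^ 'd \<Rightarrow> real) set" for B where
  gen: "b \<in> B \<Longrightarrow> b \<in> generated_algebra B"
| const: "(\<lambda>x. c) \<in> generated_algebra B"
| add: "p \<in> generated_algebra B \<Longrightarrow> q \<in> generated_algebra B \<Longrightarrow>
    (\<lambda>x. p x + q x) \<in> generated_algebra B"
| mult: "p \<in> generated_algebra B \<Longrightarrow> q \<in> generated_algebra B \<Longrightarrow>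
    (\<lambda>x. p x * q x) \<in> generated_algebra B"

lemma generated_algebra_prod:
  "(\<And>i. i \<in> I \<Longrightarrow> p i \<in> generated_algebra B) \<Longrightarrow>
    (\<lambda>x. \<Prod>i\<in>I. p i x) \<in> generated_algebra B"
  by (induction I rule: infinite_finite_induct)
     (auto intro: generated_algebra.const generated_algebra.mult)

lemma partial_deriv_eq:
  "(\<psi> has_derivative D) (at x) \<Longrightarrow> partial_deriv i \<psi> x = D (axis i 1)"
  by (simp add: partial_deriv_def frechet_derivative_at[symmetric])

lemma partial_deriv_add:
  assumes "\<psi> differentiable (at x)" "\<xi> differentiable (at x)"
  shows "partial_deriv i (\<lambda>x. \<psi> x + \<xi> x) x = partial_deriv i \<psi> x + partial_deriv i \<xi> x"
  using has_derivative_add[OF assms[unfolded frechet_derivative_works]]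
  by (simp add: partial_deriv_def frechet_derivative_at[symmetric])

lemma partial_deriv_mult:
  assumes "\<psi> differentiable (at x)" "\<xi> differentiable (at x)"
  shows "partial_deriv i (\<lambda>x. \<psi> x * \<xi> x) x =
    \<psi> x * partial_deriv i \<xi> x + partial_deriv i \<psi> x * \<xi> x"
  using has_derivative_mult[OF assms[unfolded frechet_derivative_works]]
  by (simp add: partial_deriv_def frechet_derivative_at[symmetric])

lemma partial_deriv_const: "partial_deriv i (\<lambda>x. c) = (\<lambda>x. 0)"
  by (rule ext, rule partial_deriv_eq[where D = "\<lambda>h. 0"]) simp

lemma smooth_if_in_generated_algebra:
  assumes diff: "\<And>b x. b \<in> B \<Longrightarrow> b differentiable (at x)"
    and closed: "\<And>b i. b \<in> B \<Longrightarrow> partial_deriv i b \<in> generated_algebra B"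
    and "p \<in> generated_algebra B"
  shows "smooth p"
proof -
  have d: "\<forall>x. q differentiable (at x)" if "q \<in> generated_algebra B" for q
    using that by induction (auto intro: diff)
  have c: "partial_deriv i q \<in> generated_algebra B" if "q \<in> generated_algebra B" for i q
    using that
  proof induction
    case (add p q)
    have "partial_deriv i (\<lambda>x. p x + q x) = (\<lambda>x. partial_deriv i p x + partial_deriv i q x)"
      using d add.hyps by (intro ext partial_deriv_add) auto
    then show ?case using generated_algebra.add add.IH by metis
  next
    case (mult p q)
    have "partial_deriv i (\<lambda>x. p x * q x)
        = (\<lambda>x. p x * partial_deriv i q x + partial_deriv i p x * q x)"
      using d mult.hyps by (intro ext partial_deriv_mult) auto
    then show ?case
      using generated_algebra.add[OF generated_algebra.mult[OF mult.hyps(1) mult.IH(2)]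
          generated_algebra.mult[OF mult.IH(1) mult.hyps(2)]] by simp
  qed (auto simp: partial_deriv_const closed intro: generated_algebra.const)
  have "foldr partial_deriv js p \<in> generated_algebra B" for js
    by (induction js) (auto intro: c assms(3))
  then show ?thesis by (auto simp: smooth_def d)
qed

lemma smooth_differentiable: "smooth \<psi> \<Longrightarrow> \<psi> differentiable (at x)"
  unfolding smooth_def by (drule spec[of _ "[]"]) simp

lemma smooth_partial_deriv: "smooth \<psi> \<Longrightarrow> smooth (partial_deriv i \<psi>)"
proof -
  assume "smooth \<psi>"
  then have "foldr partial_deriv (js @ [i]) \<psi> differentiable (at x)" for js x
    unfolding smooth_def by blast
  then show ?thesis by (simp add: smooth_def)
qed

lemma smooth_generated_algebra: "p \<in> generated_algebra (Collect smooth) \<Longrightarrow> smooth p"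
  by (rule smooth_if_in_generated_algebra)
     (auto intro: smooth_differentiable smooth_partial_deriv generated_algebra.gen)

lemma smooth_add: "smooth \<psi> \<Longrightarrow> smooth \<xi> \<Longrightarrow> smooth (\<lambda>x. \<psi> x + \<xi> x)"
  by (intro smooth_generated_algebra generated_algebra.add generated_algebra.gen) auto

lemma smooth_mult: "smooth \<psi> \<Longrightarrow> smooth \<xi> \<Longrightarrow> smooth (\<lambda>x. \<psi> x * \<xi> x)"
  by (intro smooth_generated_algebra generated_algebra.mult generated_algebra.gen) auto

lemma smooth_const: "smooth (\<lambda>x. c)"
  by (intro smooth_generated_algebra generated_algebra.const)

lemma has_derivative_coordinate:
  "((\<lambda>x. x $ j) has_derivative (\<lambda>h. h $ j)) (at (x :: real ^ 'd))"
  by (rule bounded_linear_imp_has_derivative[OF bounded_linear_vec_nth])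

lemma partial_deriv_coordinate:
  "partial_deriv i (\<lambda>x :: real ^ 'd. x $ j) = (\<lambda>x. if i = j then 1 else 0)"
  by (rule ext, subst partial_deriv_eq[where D = "\<lambda>h. h $ j"])
     (auto simp: has_derivative_coordinate axis_def)

lemma smooth_coordinate: "smooth (\<lambda>x :: real ^ 'd. x $ j)"
proof (rule smooth_if_in_generated_algebra[where B = "{\<lambda>x. x $ j}"])
  show "b differentiable (at x)" if "b \<in> {\<lambda>x :: real ^ 'd. x $ j}" for b x
    using that has_derivative_coordinate by (auto simp: differentiable_def)
qed (auto simp: partial_deriv_coordinate intro: generated_algebra.gen generated_algebra.const)

lemma test_functions_lincomb:
  assumes "\<psi> \<in> test_functions \<Omega>" "\<xi> \<in> test_functions \<Omega>"
  shows "(\<lambda>x. \<psi> x + c * \<xi> x) \<in> test_functions \<Omega>"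
proof -
  let ?S = "closure {x. \<psi> x \<noteq> 0} \<union> closure {x. \<xi> x \<noteq> 0}"
  have sub: "closure {x. \<psi> x + c * \<xi> x \<noteq> 0} \<subseteq> ?S"
    unfolding closure_Un[symmetric] by (rule closure_mono) auto
  have "compact ?S" "?S \<subseteq> \<Omega>" using assms by (auto simp: test_functions_def)
  have "compact (closure {x. \<psi> x + c * \<xi> x \<noteq> 0})"
    using compact_Int_closed[OF \<open>compact ?S\<close> closed_closure, of "{x. \<psi> x + c * \<xi> x \<noteq> 0}"]
    unfolding Int_absorb1[OF sub] .
  moreover have "smooth (\<lambda>x. \<psi> x + c * \<xi> x)"
    using assms by (simp add: test_functions_def smooth_add smooth_mult smooth_const)
  ultimately show ?thesis
    using sub \<open>?S \<subseteq> \<Omega>\<close> unfolding test_functions_def by blast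
qed

lemma test_functions_if_support_subset:
  assumes "\<psi> \<in> test_functions \<Omega>" "smooth \<xi>" "{x. \<xi> x \<noteq> 0} \<subseteq> closure {x. \<psi> x \<noteq> 0}"
  shows "\<xi> \<in> test_functions \<Omega>"
proof -
  have sub: "closure {x. \<xi> x \<noteq> 0} \<subseteq> closure {x. \<psi> x \<noteq> 0}"
    using assms(3) by (simp add: closure_minimal)
  moreover have "compact (closure {x. \<xi> x \<noteq> 0})"
    using assms(1) sub unfolding test_functions_def mem_Collect_eq
    by (metis closed_closure compact_Int_closed inf.absorb_iff2)
  ultimately show ?thesis using assms by (auto simp: test_functions_def)
qed

lemma test_functions_smooth_mult:
  assumes "smooth m" "\<psi> \<in> test_functions \<Omega>"
  shows "(\<lambda>x. m x * \<psi> x) \<in> test_functions \<Omega>"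
proof (rule test_functions_if_support_subset[OF assms(2)])
  show "smooth (\<lambda>x. m x * \<psi> x)"
    using assms by (auto simp: test_functions_def intro!: smooth_mult)
  show "{x. m x * \<psi> x \<noteq> 0} \<subseteq> closure {x. \<psi> x \<noteq> 0}"
    using closure_subset by fastforce
qed

lemma test_functions_partial_deriv:
  assumes "\<psi> \<in> test_functions \<Omega>"
  shows "partial_deriv i \<psi> \<in> test_functions \<Omega>"
proof (rule test_functions_if_support_subset[OF assms])
  show "smooth (partial_deriv i \<psi>)"
    using assms by (auto simp: test_functions_def intro!: smooth_partial_deriv)
  have "partial_deriv i \<psi> x = 0" if x: "x \<notin> closure {x. \<psi> x \<noteq> 0}" for x
  proof -
    have "(\<psi> has_derivative (\<lambda>h. 0)) (at x)"
    proof (rule has_derivative_transform_within_open[where f = "\<lambda>x. 0"])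
      show "open (- closure {x. \<psi> x \<noteq> 0})" by blast
      show "0 = \<psi> y" if "y \<in> - closure {x. \<psi> x \<noteq> 0}" for y
        using that closure_subset[of "{x. \<psi> x \<noteq> 0}"] by auto
    qed (use x in auto)
    then show ?thesis using partial_deriv_eq[of \<psi> "\<lambda>h. 0" x] by simp
  qed
  then show "{x. partial_deriv i \<psi> x \<noteq> 0} \<subseteq> closure {x. \<psi> x \<noteq> 0}" by auto
qed

lemma L2_bounded:
  assumes "\<Omega> \<in> lmeasurable" "m \<in> borel_measurable (lebesgue_on \<Omega>)"
    and "\<And>x. x \<in> \<Omega> \<Longrightarrow> \<bar>m x\<bar> \<le> B"
  shows "m \<in> L2 \<Omega>"
proof -
  interpret finite_measure "lebesgue_on \<Omega>"
    by (rule finite_measure_lebesgue_on[OF assms(1)])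
  have "(\<lambda>x. 1) \<in> L2 \<Omega>" by (simp add: L2_def)
  from L2_times_bounded[OF this assms(2,3)] show ?thesis by simp
qed

lemma lmeasurable_open_bounded: "open \<Omega> \<Longrightarrow> bounded \<Omega> \<Longrightarrow> \<Omega> \<in> lmeasurable"
  by (simp add: lmeasurable_open)

lemma test_functions_continuous:
  "\<psi> \<in> test_functions \<Omega> \<Longrightarrow> continuous_on UNIV \<psi>"
  by (auto simp: test_functions_def continuous_on_eq_continuous_at
      intro!: differentiable_imp_continuous_within smooth_differentiable)

lemma test_functions_L2:
  assumes "open \<Omega>" "bounded \<Omega>" "\<psi> \<in> test_functions \<Omega>"
  shows "\<psi> \<in> L2 \<Omega>"
proof -
  let ?K = "closure {x. \<psi> x \<noteq> 0}"
  have "compact (\<psi> ` ?K)"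
    using assms(3) continuous_on_subset[OF test_functions_continuous[OF assms(3)] subset_UNIV]
    by (intro compact_continuous_image) (simp_all add: test_functions_def)
  then have "bounded (\<psi> ` ?K)" by (rule compact_imp_bounded)
  then obtain B where B: "\<And>x. x \<in> ?K \<Longrightarrow> \<bar>\<psi> x\<bar> \<le> B"
    unfolding bounded_iff by auto
  have "\<bar>\<psi> x\<bar> \<le> max B 0" for x
    using B[of x] closure_subset[of "{x. \<psi> x \<noteq> 0}"] by (cases "\<psi> x = 0") auto
  moreover have "\<psi> \<in> borel_measurable (lebesgue_on \<Omega>)"
    using assms(1) continuous_on_subset[OF test_functions_continuous[OF assms(3)] subset_UNIV]
    by (intro continuous_imp_measurable_on_sets_lebesgue) simp_all
  ultimately show ?thesis
    by (intro L2_bounded[of _ _ "max B 0"] lmeasurable_open_bounded assms(1,2))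
qed

section \<open>The fundamental lemma of the calculus of variations\<close>

text \<open>
  The functions \<open>exp (-1/t) / t\<^sup>k\<close>, extended by zero to \<open>t \<le> 0\<close>. Allowing all \<open>k\<close> makes the family closed
  under differentiation up to linear combinations.
\<close>

definition ramp :: "nat \<Rightarrow> real \<Rightarrow> real" where
  "ramp k t = (if t > 0 then exp (- (1 / t)) / t ^ k else 0)"

lemma ramp_tendsto_0: "(ramp k \<longlongrightarrow> 0) (at 0)"
proof -
  have "((\<lambda>t. (inverse t) ^ k / exp (inverse t)) \<longlongrightarrow> 0) (at_right (0::real))"
    by (rule filterlim_compose[OF tendsto_power_div_exp_0 filterlim_inverse_at_top_right])
  then have "(ramp k \<longlongrightarrow> 0) (at_right 0)"
  proof (rule Lim_transform_eventually)
    show "\<forall>\<^sub>F t in at_right 0. inverse t ^ k / exp (inverse t) = ramp k t"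
      unfolding eventually_at_filter
      by (rule always_eventually) (auto simp: ramp_def exp_minus field_simps)
  qed
  moreover have "(ramp k \<longlongrightarrow> 0) (at_left 0)"
  proof (rule Lim_transform_eventually[OF tendsto_const])
    show "\<forall>\<^sub>F t in at_left 0. 0 = ramp k t"
      unfolding eventually_at_filter by (rule always_eventually) (auto simp: ramp_def)
  qed
  ultimately show ?thesis by (simp add: filterlim_at_split)
qed

lemma ramp_has_real_derivative:
  "(ramp k has_real_derivative (ramp (k + 2) t - k * ramp (k + 1) t)) (at t)"
proof (cases "t = 0")
  case True
  have "((\<lambda>h. (ramp k (0 + h) - ramp k 0) / h) \<longlongrightarrow> 0) (at 0)"
  proof (rule Lim_transform_eventually[OF ramp_tendsto_0[of "k + 1"]])
    show "\<forall>\<^sub>F h in at 0. ramp (k + 1) h = (ramp k (0 + h) - ramp k 0) / h"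
      by (rule always_eventually) (auto simp: ramp_def field_simps)
  qed
  then show ?thesis using True by (simp add: DERIV_def ramp_def)
next
  case nz: False
  show ?thesis
  proof (cases "t > 0")
    case True
    have "((\<lambda>s. exp (- (1 / s)) / s ^ k) has_real_derivative
        (exp (- (1 / t)) * (1 / t\<^sup>2) * t ^ k - exp (- (1 / t)) * (k * t ^ (k - 1))) / (t ^ k * t ^ k))
        (at t)"
      using True by (auto intro!: derivative_eq_intros simp: power2_eq_square)
    also have "(exp (- (1 / t)) * (1 / t\<^sup>2) * t ^ k - exp (- (1 / t)) * (k * t ^ (k - 1))) / (t ^ k * t ^ k)
        = ramp (k + 2) t - k * ramp (k + 1) t"
      using True by (cases k) (simp_all add: ramp_def field_simps power2_eq_square)
    finally show ?thesis
      by (rule has_field_derivative_transform_within_open[where S = "{0<..}"])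
         (use True in \<open>auto simp: ramp_def\<close>)
  next
    case False
    have "((\<lambda>s. 0) has_real_derivative (ramp (k + 2) t - k * ramp (k + 1) t)) (at t)"
      using False by (simp add: ramp_def)
    then show ?thesis
      by (rule has_field_derivative_transform_within_open[where S = "{..<0}"])
         (use False nz in \<open>auto simp: ramp_def\<close>)
  qed
qed

lemma ramp_coordinate_has_derivative:
  "((\<lambda>x :: real ^ 'd. ramp k (\<alpha> * x $ j + \<beta>)) has_derivative
    (\<lambda>h. (\<alpha> * h $ j) * (ramp (k + 2) (\<alpha> * x $ j + \<beta>) - k * ramp (k + 1) (\<alpha> * x $ j + \<beta>)))) (at x)"
proof -
  have "((\<lambda>x :: real ^ 'd. \<alpha> * x $ j + \<beta>) has_derivative (\<lambda>h. \<alpha> * h $ j)) (at x)"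
    using has_derivative_coordinate[of j x] by (auto intro!: derivative_eq_intros)
  from DERIV_compose_FDERIV[OF ramp_has_real_derivative this] show ?thesis .
qed

lemma smooth_if_in_ramp_algebra:
  assumes "p \<in> generated_algebra (\<Union>k \<alpha> j \<beta>. {\<lambda>x :: real ^ 'd. ramp k (\<alpha> * x $ j + \<beta>)})"
    (is "_ \<in> generated_algebra ?B")
  shows "smooth p"
proof (rule smooth_if_in_generated_algebra[OF _ _ assms])
  show "b differentiable (at x)" if "b \<in> ?B" for b x
    using that ramp_coordinate_has_derivative unfolding differentiable_def by blast
  show "partial_deriv i b \<in> generated_algebra ?B" if b: "b \<in> ?B" for b i
  proof -
    from b obtain k \<alpha> j \<beta> where b: "b = (\<lambda>x. ramp k (\<alpha> * x $ j + \<beta>))" by blast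
    have mem: "(\<lambda>x. ramp k (\<alpha> * x $ j + \<beta>)) \<in> generated_algebra ?B" for k
      by (rule generated_algebra.gen) blast
    have "partial_deriv i b = (\<lambda>x. (\<alpha> * axis i 1 $ j) *
        (ramp (k + 2) (\<alpha> * x $ j + \<beta>) + - real k * ramp (k + 1) (\<alpha> * x $ j + \<beta>)))"
      unfolding b by (rule ext) (simp add: partial_deriv_eq[OF ramp_coordinate_has_derivative])
    also have "\<dots> \<in> generated_algebra ?B"
      by (intro generated_algebra.add generated_algebra.mult generated_algebra.const mem)
    finally show ?thesis .
  qed
qed

text \<open>
  The scaling by \<open>m\<close> sharpens the bump: \<open>exp (-1/(m c))\<close> tends to \<open>1\<close> for every \<open>c > 0\<close>.
\<close>

definition box_bump :: "real ^ 'd \<Rightarrow> real ^ 'd \<Rightarrow> nat \<Rightarrow> real ^ 'd \<Rightarrow> real" where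
  "box_bump a b m = (\<lambda>x. \<Prod>j\<in>UNIV.
    ramp 0 (real m * x $ j + - real m * a $ j) * ramp 0 (- real m * x $ j + real m * b $ j))"

lemma box_bump_outside: "x \<notin> box a b \<Longrightarrow> box_bump a b m x = 0"
proof -
  assume "x \<notin> box a b"
  then obtain j where "x $ j \<le> a $ j \<or> b $ j \<le> x $ j" by (auto simp: mem_box_cart not_less)
  then have "real m * x $ j \<le> real m * a $ j \<or> real m * b $ j \<le> real m * x $ j"
    by (auto intro: mult_left_mono)
  then show ?thesis unfolding box_bump_def by (intro prod_zero bexI[of _ j]) (auto simp: ramp_def)
qed

lemma box_bump_bounds: "0 \<le> box_bump a b m x" "box_bump a b m x \<le> 1"
proof -
  have "0 \<le> ramp 0 t" "ramp 0 t \<le> 1" for t by (auto simp: ramp_def)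
  then show "0 \<le> box_bump a b m x" "box_bump a b m x \<le> 1"
    unfolding box_bump_def by (auto intro!: prod_nonneg prod_le_1 mult_le_one)
qed

lemma box_bump_tendsto_indicator: "(\<lambda>m. box_bump a b m x) \<longlonglongrightarrow> indicator (box a b) x"
proof (cases "x \<in> box a b")
  case True
  have one: "(\<lambda>m. ramp 0 (real m * c)) \<longlonglongrightarrow> 1" if "c > 0" for c
  proof -
    have "(\<lambda>m. exp (- (inverse c * inverse (real m)))) \<longlonglongrightarrow> exp (- (inverse c * 0))"
      by (intro tendsto_intros lim_inverse_n)
    moreover have "\<forall>\<^sub>F m in sequentially. exp (- (inverse c * inverse (real m))) = ramp 0 (real m * c)"
      using eventually_gt_at_top[of 0]
      by eventually_elim (use that in \<open>simp add: ramp_def field_simps\<close>)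
    ultimately show ?thesis by (simp add: Lim_transform_eventually)
  qed
  have eq: "box_bump a b m x = (\<Prod>j\<in>UNIV. ramp 0 (real m * (x $ j - a $ j)) * ramp 0 (real m * (b $ j - x $ j)))" for m
    unfolding box_bump_def by (simp add: algebra_simps)
  have "(\<lambda>m. box_bump a b m x) \<longlonglongrightarrow> (\<Prod>j\<in>(UNIV :: 'a set). 1 * 1)"
    unfolding eq using True by (intro tendsto_prod tendsto_mult one) (auto simp: mem_box_cart)
  then show ?thesis using True by simp
qed (simp add: box_bump_outside)

lemma box_bump_test_function:
  assumes "cbox a b \<subseteq> \<Omega>"
  shows "box_bump a b m \<in> test_functions \<Omega>"
proof -
  have "smooth (box_bump a b m)"
    unfolding box_bump_def
    by (intro smooth_if_in_ramp_algebra generated_algebra_prod generated_algebra.mult generated_algebra.gen)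
       blast+
  moreover have sub: "closure {x. box_bump a b m x \<noteq> 0} \<subseteq> cbox a b"
    using box_bump_outside[of _ a b m] box_subset_cbox[of a b] by (intro closure_minimal) auto
  moreover have "compact (closure {x. box_bump a b m x \<noteq> 0})"
    using sub by (meson bounded_cbox bounded_subset closed_closure compact_eq_bounded_closed)
  ultimately show ?thesis using assms by (auto simp: test_functions_def)
qed

text \<open>
  The sets over which \<open>g\<close> integrates to \<open>0\<close> form a Dynkin system, and open boxes are an
  intersection-stable generator of the Borel sets. The integral over the whole space is
  what complements require.
\<close>

lemma AE_0_if_box_integrals_0:
  fixes g :: "real ^ 'd \<Rightarrow> real"
  assumes g: "integrable lborel g" and box: "\<And>a b. (LINT x|lborel. indicator (box a b) x * g x) = 0"
    and total: "(LINT x|lborel. g x) = 0"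
  shows "AE x in lborel. g x = 0"
proof (rule sigma_finite_measure.density_zero[OF sigma_finite_lborel g])
  fix A :: "(real ^ 'd) set" assume "A \<in> sets lborel"
  let ?E = "range (\<lambda>(a, b). box a b :: (real ^ 'd) set)"
  have int: "integrable lborel (\<lambda>x. indicator A x * g x)" if "A \<in> sets borel" for A
    using integrable_mult_indicator[OF _ g, of A] that by simp
  have "Int_stable ?E" by (auto simp: Int_stable_def box_Int_box)
  moreover have "?E \<subseteq> Pow UNIV" by simp
  moreover have "A \<in> sigma_sets UNIV ?E" using \<open>A \<in> sets lborel\<close> by (simp add: borel_eq_box)
  ultimately have "(LINT x|lborel. indicator A x * g x) = 0"
  proof (induction rule: sigma_sets_induct_disjoint)
    case (basic A)
    then show ?case using box by auto
  next
    case empty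
    then show ?case by simp
  next
    case (compl A)
    then have A: "A \<in> sets borel" by (simp add: borel_eq_box)
    have "(LINT x|lborel. indicator (UNIV - A) x * g x) = (LINT x|lborel. g x - indicator A x * g x)"
      by (rule Bochner_Integration.integral_cong) (auto simp: indicator_def)
    then show ?case using compl int[OF A] g total by simp
  next
    case (union A)
    then have A: "A i \<in> sets borel" for i by (auto simp: borel_eq_box)
    have "(LINT x:(\<Union>i. A i)|lborel. g x) = (\<Sum>i. LINT x:A i|lborel. g x)"
    proof (rule lebesgue_integral_countable_add)
      show "A i \<inter> A j = {}" if "i \<noteq> j" for i j
        using union(1) that by (auto simp: disjoint_family_on_def)
      show "set_integrable lborel (\<Union>i. A i) g"
        using int[of "\<Union>i. A i"] A by (auto simp: set_integrable_def)
    qed (use A in auto)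
    then show ?case using union by (simp add: set_lebesgue_integral_def)
  qed
  then show "set_lebesgue_integral lborel A g = 0" by (simp add: set_lebesgue_integral_def)
qed

text \<open>
  The fundamental lemma of the calculus of variations. Letting the bumps of a box whose closure lies
  in \<open>\<Omega>\<close> converge to its indicator function shows that \<open>g\<close> has integral zero over the box; the
  domain is a countable union of closed boxes, and the boundary of a box is a null set.
\<close>

lemma AE_0_if_orthogonal_to_test_functions:
  fixes g :: "real ^ 'd \<Rightarrow> real"
  assumes \<Omega>: "open \<Omega>" "bounded \<Omega>" and g: "g \<in> L2 \<Omega>"
    and orth: "\<And>\<psi>. \<psi> \<in> test_functions \<Omega> \<Longrightarrow> L2_inner \<Omega> g \<psi> = 0"
  shows "AE x in lebesgue_on \<Omega>. g x = 0"
proof -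
  interpret finite_measure "lebesgue_on \<Omega>"
    by (rule finite_measure_lebesgue_on[OF lmeasurable_open_bounded[OF \<Omega>]])
  have "(\<lambda>x. 1) \<in> L2 \<Omega>" by (simp add: L2_def)
  from L2_integrable_mult[OF g this] have g1: "integrable (lebesgue_on \<Omega>) g" by simp
  have meas: "\<Omega> \<in> sets lebesgue" using \<Omega> by simp
  have box0: "(LINT x|lebesgue_on \<Omega>. indicator (box a b) x * g x) = 0" if ab: "cbox a b \<subseteq> \<Omega>" for a b
  proof -
    have "(\<lambda>m. LINT x|lebesgue_on \<Omega>. box_bump a b m x * g x)
        \<longlonglongrightarrow> (LINT x|lebesgue_on \<Omega>. indicator (box a b) x * g x)"
    proof (rule integral_dominated_convergence[where w = "\<lambda>x. \<bar>g x\<bar>"])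
      have "indicator (box a b) \<in> borel_measurable (lebesgue_on \<Omega>)"
        by (intro measurable_restrict_space1 borel_measurable_indicator) simp
      then show "(\<lambda>x. indicator (box a b) x * g x) \<in> borel_measurable (lebesgue_on \<Omega>)"
        using L2_borel[OF g] by measurable
      show "(\<lambda>x. box_bump a b m x * g x) \<in> borel_measurable (lebesgue_on \<Omega>)" for m
        using L2_borel[OF test_functions_L2[OF \<Omega> box_bump_test_function[OF ab]]] L2_borel[OF g]
        by measurable
      show "integrable (lebesgue_on \<Omega>) (\<lambda>x. \<bar>g x\<bar>)" using g1 by simp
      show "AE x in lebesgue_on \<Omega>. (\<lambda>m. box_bump a b m x * g x) \<longlonglongrightarrow> indicator (box a b) x * g x"
        by (intro AE_I2 tendsto_intros box_bump_tendsto_indicator)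
      show "AE x in lebesgue_on \<Omega>. norm (box_bump a b m x * g x) \<le> \<bar>g x\<bar>" for m
        using box_bump_bounds[of a b m] by (intro AE_I2) (simp add: abs_mult mult_left_le_one_le)
    qed
    moreover have "(LINT x|lebesgue_on \<Omega>. box_bump a b m x * g x) = 0" for m
      using orth[OF box_bump_test_function[OF ab]] by (simp add: L2_inner_def mult.commute)
    ultimately show ?thesis by (simp add: LIMSEQ_const_iff)
  qed
  have on_box: "AE x in lebesgue. x \<in> box a b \<longrightarrow> g x = 0" if ab: "cbox a b \<subseteq> \<Omega>" for a b
  proof -
    \<comment> \<open>Averaging over Borel sets is a statement about \<open>lborel\<close>, so \<open>g\<close> is cut off and replaced by a Borel function.\<close>
    define G where "G = (\<lambda>x. indicator (box a b) x * g x)"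
    have subs: "box a b \<subseteq> \<Omega>" using ab box_subset_cbox by blast
    have ind: "indicator \<Omega> x *\<^sub>R (indicator (box c d) x * g x) = indicator (box c d) x * g x"
      if "box c d \<subseteq> \<Omega>" for c d x
      using that by (auto simp: indicator_def)
    have G: "integrable lebesgue G"
    proof -
      have "integrable lebesgue (\<lambda>x. indicator \<Omega> x *\<^sub>R g x)"
        using g1 integrable_restrict_space[of \<Omega> lebesgue g] meas by simp
      then have "integrable lebesgue (\<lambda>x. indicator (box a b) x *\<^sub>R (indicator \<Omega> x *\<^sub>R g x))"
        by (rule integrable_mult_indicator[rotated]) simp
      also have "(\<lambda>x. indicator (box a b) x *\<^sub>R (indicator \<Omega> x *\<^sub>R g x)) = G"
        using subs unfolding G_def by (intro ext) (auto simp: indicator_def)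
      finally show ?thesis .
    qed
    have G0: "(LINT x|lebesgue. indicator (box c d) x * G x) = 0" for c d
    proof -
      obtain a' b' where ab': "box a b \<inter> box c d = box a' b'" "cbox a b \<inter> cbox c d = cbox a' b'"
        by (rule that[OF box_Int_box Int_interval])
      have "(LINT x|lebesgue. indicator (box c d) x * G x)
          = (LINT x|lebesgue. indicator \<Omega> x *\<^sub>R (indicator (box a' b') x * g x))"
        using ab' subs ind[of a' b']
        by (intro Bochner_Integration.integral_cong) (auto simp: G_def indicator_def split: if_splits)
      also have "\<dots> = (LINT x|lebesgue_on \<Omega>. indicator (box a' b') x * g x)"
        using meas by (intro integral_restrict_space[symmetric]) simp
      also have "\<dots> = 0" using ab ab' by (intro box0) auto
      finally show ?thesis .
    qed
    obtain G' where G': "G' \<in> borel_measurable lborel" "AE x in lborel. G x = G' x"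
      using completion_ex_borel_measurable_real[of G lborel] G by auto
    have AE: "AE x in lebesgue. G x = G' x" using G'(2) by (rule AE_completion)
    have "integrable lebesgue G'"
      using G AE G'(1) by (subst integrable_cong_AE[where g = G]) (auto simp: measurable_completion)
    then have int: "integrable lborel G'" using G'(1) by (simp add: integrable_completion)
    have transfer: "(LINT x|lborel. indicator B x * G' x) = (LINT x|lebesgue. indicator B x * G x)"
      if "B \<in> sets borel" for B
    proof -
      have m: "(\<lambda>x. indicator B x * G' x) \<in> borel_measurable lborel"
        using that G'(1) by measurable
      have m2: "(\<lambda>x. indicator B x * G x) \<in> borel_measurable lebesgue"
        using that G by (intro borel_measurable_times borel_measurable_indicator) auto
      show ?thesis
        unfolding integral_completion[OF m, symmetric]
        by (rule integral_cong_AE) (use m m2 AE in \<open>auto simp: measurable_completion\<close>)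
    qed
    have "AE x in lborel. G' x = 0"
    proof (rule AE_0_if_box_integrals_0[OF int])
      show "(LINT x|lborel. indicator (box c d) x * G' x) = 0" for c d
        using transfer[of "box c d"] G0 by simp
      have "(LINT x|lborel. G' x) = (LINT x|lebesgue. G x)"
        using transfer[of UNIV] by simp
      also have "\<dots> = (LINT x|lebesgue. indicator (box a b) x * G x)"
        by (intro Bochner_Integration.integral_cong) (auto simp: G_def indicator_def)
      finally show "(LINT x|lborel. G' x) = 0" using G0 by simp
    qed
    from AE_completion[OF this] AE have "AE x in lebesgue. G x = 0" by eventually_elim simp
    then show ?thesis by eventually_elim (auto simp: G_def)
  qed
  obtain D where D: "countable D" "D \<subseteq> Pow \<Omega>" "\<And>X. X \<in> D \<Longrightarrow> \<exists>a b. X = cbox a b" "\<Union>D = \<Omega>"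
    using open_countable_Union_open_cbox[OF \<Omega>(1)] by metis
  have "AE x in lebesgue. \<forall>X\<in>D. x \<in> X \<longrightarrow> g x = 0"
    unfolding AE_ball_countable[OF D(1)]
  proof
    fix X assume X: "X \<in> D"
    then obtain a b where ab: "X = cbox a b" using D(3) by blast
    have "AE x in lebesgue. x \<notin> cbox a b - box a b"
      using negligible_frontier_interval[of a b] by (intro AE_not_in) (simp add: negligible_iff_null_sets)
    moreover have "AE x in lebesgue. x \<in> box a b \<longrightarrow> g x = 0"
      using on_box[of a b] X D(2) ab by auto
    ultimately show "AE x in lebesgue. x \<in> X \<longrightarrow> g x = 0"
      unfolding ab by eventually_elim blast
  qed
  then have "AE x in lebesgue. x \<in> \<Omega> \<longrightarrow> g x = 0"
    by eventually_elim (use D(4) in blast)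
  then show ?thesis using meas by (simp add: AE_restrict_space_iff)
qed

section \<open>Weak gradients and \<open>H\<^sub>0\<^sup>1\<close>\<close>

lemma has_weak_gradient_component_L2: "has_weak_gradient \<Omega> u g \<Longrightarrow> (\<lambda>x. g x $ i) \<in> L2 \<Omega>"
  by (simp add: has_weak_gradient_def)

lemma has_weak_gradientD:
  "has_weak_gradient \<Omega> u g \<Longrightarrow> \<psi> \<in> test_functions \<Omega> \<Longrightarrow>
    L2_inner \<Omega> u (partial_deriv i \<psi>) = - L2_inner \<Omega> (\<lambda>x. g x $ i) \<psi>"
  by (simp add: has_weak_gradient_def)

lemma H1_L2: "u \<in> H1 \<Omega> \<Longrightarrow> u \<in> L2 \<Omega>"
  by (simp add: H1_def)

lemma has_weak_gradient_grad: "u \<in> H1 \<Omega> \<Longrightarrow> has_weak_gradient \<Omega> u (grad \<Omega> u)"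
  unfolding H1_def grad_def by (auto intro: someI[of "has_weak_gradient \<Omega> u"])

lemma H10_H1: "u \<in> H10 \<Omega> \<Longrightarrow> u \<in> H1 \<Omega>"
  by (simp add: H10_def)

lemma H10_L2: "u \<in> H10 \<Omega> \<Longrightarrow> u \<in> L2 \<Omega>"
  by (simp add: H10_H1 H1_L2)

lemma integral_inner_eq_sum_L2_inner:
  fixes v w :: "real ^ 'd \<Rightarrow> real ^ 'd"
  assumes "\<And>i. (\<lambda>x. v x $ i) \<in> L2 \<Omega>" "\<And>i. (\<lambda>x. w x $ i) \<in> L2 \<Omega>"
  shows "(LINT x|lebesgue_on \<Omega>. v x \<bullet> w x)
    = (\<Sum>i\<in>UNIV. L2_inner \<Omega> (\<lambda>x. v x $ i) (\<lambda>x. w x $ i))"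
proof -
  have "(LINT x|lebesgue_on \<Omega>. v x \<bullet> w x) = (LINT x|lebesgue_on \<Omega>. (\<Sum>i\<in>UNIV. v x $ i * w x $ i))"
    by (simp add: inner_vec_def)
  also have "\<dots> = (\<Sum>i\<in>UNIV. (LINT x|lebesgue_on \<Omega>. v x $ i * w x $ i))"
    by (rule Bochner_Integration.integral_sum) (rule L2_integrable_mult[OF assms])
  finally show ?thesis by (simp add: L2_inner_def)
qed

lemma grad_inner_eq_sum:
  assumes "u \<in> H1 \<Omega>" "v \<in> H1 \<Omega>"
  shows "grad_inner \<Omega> u v
    = (\<Sum>i\<in>UNIV. L2_inner \<Omega> (\<lambda>x. grad \<Omega> u x $ i) (\<lambda>x. grad \<Omega> v x $ i))"
  unfolding grad_inner_def
  by (rule integral_inner_eq_sum_L2_inner)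
     (use assms has_weak_gradient_grad has_weak_gradient_component_L2 in blast)+

lemma grad_inner_self_nonneg: "0 \<le> grad_inner \<Omega> u u"
  by (simp add: grad_inner_def)

locale bounded_open_set =
  fixes \<Omega> :: "(real ^ 'd) set"
  assumes open_\<Omega>: "open \<Omega>" and bounded_\<Omega>: "bounded \<Omega>"
begin

lemmas test_L2 = test_functions_L2[OF open_\<Omega> bounded_\<Omega>]
lemmas partial_L2 = test_L2[OF test_functions_partial_deriv]

lemma has_weak_gradient_lincomb:
  assumes "u \<in> L2 \<Omega>" "v \<in> L2 \<Omega>" "has_weak_gradient \<Omega> u g" "has_weak_gradient \<Omega> v h"
  shows "has_weak_gradient \<Omega> (\<lambda>x. u x + c * v x) (\<lambda>x. g x + c *\<^sub>R h x)"
  unfolding has_weak_gradient_def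
proof (intro conjI allI ballI)
  note L2s = assms(3,4)[THEN has_weak_gradient_component_L2]
  show "(\<lambda>x. (g x + c *\<^sub>R h x) $ i) \<in> L2 \<Omega>" for i
    using L2_lincomb[OF L2s] by simp
  show "L2_inner \<Omega> (\<lambda>x. u x + c * v x) (partial_deriv i \<psi>) =
      - L2_inner \<Omega> (\<lambda>x. (g x + c *\<^sub>R h x) $ i) \<psi>" if "\<psi> \<in> test_functions \<Omega>" for i \<psi>
    using L2_inner_lincomb[OF assms(1,2) partial_L2[OF that]]
      L2_inner_lincomb[OF L2s test_L2[OF that]] assms(3,4)[THEN has_weak_gradientD, OF that]
    by (simp add: algebra_simps)
qed

lemma has_weak_gradient_cong_AE:
  assumes "u \<in> L2 \<Omega>" "v \<in> L2 \<Omega>" "AE x in lebesgue_on \<Omega>. u x = v x"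
  shows "has_weak_gradient \<Omega> u = has_weak_gradient \<Omega> v"
proof -
  have "L2_inner \<Omega> u (partial_deriv i \<psi>) = L2_inner \<Omega> v (partial_deriv i \<psi>)"
    if "\<psi> \<in> test_functions \<Omega>" for i \<psi>
    using L2_inner_cong_AE[OF assms(3,1,2) partial_L2[OF that]] .
  then show ?thesis by (intro ext) (auto simp: has_weak_gradient_def)
qed

lemma grad_cong_AE:
  assumes "u \<in> L2 \<Omega>" "v \<in> L2 \<Omega>" "AE x in lebesgue_on \<Omega>. u x = v x"
  shows "grad \<Omega> u = grad \<Omega> v"
  unfolding grad_def has_weak_gradient_cong_AE[OF assms] ..

lemma grad_inner_cong_AE:
  assumes "u \<in> L2 \<Omega>" "v \<in> L2 \<Omega>" "AE x in lebesgue_on \<Omega>. u x = v x"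
  shows "grad_inner \<Omega> u w = grad_inner \<Omega> v w"
  unfolding grad_inner_def grad_cong_AE[OF assms] ..

text \<open>
  This lets the gradient chosen by \<open>grad\<close> be replaced by any weak gradient at hand. Closure of
  \<open>H\<^sub>0\<^sup>1\<close> under sums and bilinearity of \<open>grad_inner\<close> both rest on it.
\<close>

lemma weak_gradient_unique:
  assumes "has_weak_gradient \<Omega> u g" "has_weak_gradient \<Omega> u h"
  shows "AE x in lebesgue_on \<Omega>. g x = h x"
proof -
  note L2s = assms[THEN has_weak_gradient_component_L2]
  have "AE x in lebesgue_on \<Omega>. g x $ i - h x $ i = 0" for i
  proof (rule AE_0_if_orthogonal_to_test_functions[OF open_\<Omega> bounded_\<Omega> L2_diff[OF L2s]])
    show "L2_inner \<Omega> (\<lambda>x. g x $ i - h x $ i) \<psi> = 0" if "\<psi> \<in> test_functions \<Omega>" for \<psi>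
      using L2_inner_diff[OF L2s test_L2[OF that]] assms[THEN has_weak_gradientD, OF that, of i]
      by simp
  qed
  then have "AE x in lebesgue_on \<Omega>. \<forall>i. g x $ i - h x $ i = 0"
    by (rule eventually_all_finite)
  then show ?thesis by eventually_elim (simp add: vec_eq_iff)
qed

lemma H1_lincomb:
  assumes "u \<in> H1 \<Omega>" "v \<in> H1 \<Omega>"
  shows "(\<lambda>x. u x + c * v x) \<in> H1 \<Omega>"
  using L2_lincomb[OF assms[THEN H1_L2]]
    has_weak_gradient_lincomb[OF assms[THEN H1_L2] assms[THEN has_weak_gradient_grad]]
  by (auto simp: H1_def)

lemma grad_lincomb_AE:
  assumes "u \<in> H1 \<Omega>" "v \<in> H1 \<Omega>"
  shows "AE x in lebesgue_on \<Omega>. grad \<Omega> (\<lambda>x. u x + c * v x) x = grad \<Omega> u x + c *\<^sub>R grad \<Omega> v x"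
  by (rule weak_gradient_unique[OF has_weak_gradient_grad[OF H1_lincomb[OF assms]]
      has_weak_gradient_lincomb[OF assms[THEN H1_L2] assms[THEN has_weak_gradient_grad]]])

lemma grad_inner_lincomb:
  assumes "u \<in> H1 \<Omega>" "v \<in> H1 \<Omega>" "w \<in> H1 \<Omega>"
  shows "grad_inner \<Omega> (\<lambda>x. u x + c * v x) w = grad_inner \<Omega> u w + c * grad_inner \<Omega> v w"
proof -
  note uv = H1_lincomb[OF assms(1,2), of c]
  note L2s = has_weak_gradient_component_L2[OF has_weak_gradient_grad]
  have "L2_inner \<Omega> (\<lambda>x. grad \<Omega> (\<lambda>x. u x + c * v x) x $ i) (\<lambda>x. grad \<Omega> w x $ i)
      = L2_inner \<Omega> (\<lambda>x. grad \<Omega> u x $ i) (\<lambda>x. grad \<Omega> w x $ i)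
      + c * L2_inner \<Omega> (\<lambda>x. grad \<Omega> v x $ i) (\<lambda>x. grad \<Omega> w x $ i)" for i
  proof -
    have "AE x in lebesgue_on \<Omega>.
        grad \<Omega> (\<lambda>x. u x + c * v x) x $ i = grad \<Omega> u x $ i + c * grad \<Omega> v x $ i"
      using grad_lincomb_AE[OF assms(1,2), of c] by eventually_elim simp
    from L2_inner_cong_AE[OF this L2s[OF uv] L2_lincomb[OF L2s[OF assms(1)] L2s[OF assms(2)]]
        L2s[OF assms(3)]]
    show ?thesis
      using L2_inner_lincomb[OF L2s[OF assms(1)] L2s[OF assms(2)] L2s[OF assms(3)]] by simp
  qed
  then show ?thesis
    by (simp add: grad_inner_eq_sum uv assms sum.distrib sum_distrib_left)
qed

lemma grad_inner_diff:
  assumes "u \<in> H1 \<Omega>" "v \<in> H1 \<Omega>" "w \<in> H1 \<Omega>"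
  shows "grad_inner \<Omega> (\<lambda>x. u x - v x) w = grad_inner \<Omega> u w - grad_inner \<Omega> v w"
  using grad_inner_lincomb[OF assms, of "-1"] by simp

text \<open>
  With this identity convergence in \<open>H\<^sup>1\<close> becomes convergence of the function and of each partial
  derivative separately in the \<open>L\<^sup>2\<close> norm, where the triangle inequality is available.
\<close>

lemma H1_distance_eq:
  assumes "u \<in> H1 \<Omega>" "\<psi> \<in> test_functions \<Omega>"
  shows "(LINT x|lebesgue_on \<Omega>. (u x - \<psi> x)\<^sup>2) +
      (LINT x|lebesgue_on \<Omega>. (norm (grad \<Omega> u x - (\<chi> i. partial_deriv i \<psi> x)))\<^sup>2)
    = (L2_norm \<Omega> (\<lambda>x. u x - \<psi> x))\<^sup>2 +
      (\<Sum>i\<in>UNIV. (L2_norm \<Omega> (\<lambda>x. grad \<Omega> u x $ i - partial_deriv i \<psi> x))\<^sup>2)"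
proof -
  have "(\<lambda>x. (grad \<Omega> u x - (\<chi> i. partial_deriv i \<psi> x)) $ i) \<in> L2 \<Omega>" for i
    using L2_diff[OF has_weak_gradient_component_L2[OF has_weak_gradient_grad[OF assms(1)]]
        partial_L2[OF assms(2)], of i i] by simp
  from integral_inner_eq_sum_L2_inner[OF this this] show ?thesis
    by (simp add: L2_norm_square power2_norm_eq_inner)
       (simp add: L2_inner_def power2_eq_square)
qed

lemma H10_approximation:
  assumes "u \<in> H10 \<Omega>"
  obtains \<psi> :: "nat \<Rightarrow> real ^ 'd \<Rightarrow> real" where "\<And>k. \<psi> k \<in> test_functions \<Omega>"
    and "(\<lambda>k. L2_norm \<Omega> (\<lambda>x. u x - \<psi> k x)) \<longlonglongrightarrow> 0"
    and "\<And>i. (\<lambda>k. L2_norm \<Omega> (\<lambda>x. grad \<Omega> u x $ i - partial_deriv i (\<psi> k) x)) \<longlonglongrightarrow> 0"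
proof -
  obtain \<psi> :: "nat \<Rightarrow> real ^ 'd \<Rightarrow> real" where test: "\<And>k. \<psi> k \<in> test_functions \<Omega>"
    and lim0: "(\<lambda>k. (LINT x|lebesgue_on \<Omega>. (u x - \<psi> k x)\<^sup>2) +
         (LINT x|lebesgue_on \<Omega>. (norm (grad \<Omega> u x - (\<chi> i. partial_deriv i (\<psi> k) x)))\<^sup>2))
      \<longlonglongrightarrow> 0"
    using assms unfolding H10_def by blast
  let ?p = "\<lambda>k. (L2_norm \<Omega> (\<lambda>x. u x - \<psi> k x))\<^sup>2"
  let ?q = "\<lambda>k i. (L2_norm \<Omega> (\<lambda>x. grad \<Omega> u x $ i - partial_deriv i (\<psi> k) x))\<^sup>2"
  have lim: "(\<lambda>k. ?p k + (\<Sum>i\<in>UNIV. ?q k i)) \<longlonglongrightarrow> 0"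
    using lim0 by (simp only: H1_distance_eq[OF H10_H1[OF assms] test])
  have part: "(\<lambda>k. L2_norm \<Omega> (v k)) \<longlonglongrightarrow> 0"
    if "\<And>k. (L2_norm \<Omega> (v k))\<^sup>2 \<le> ?p k + (\<Sum>i\<in>UNIV. ?q k i)" for v
  proof -
    have "(\<lambda>k. (L2_norm \<Omega> (v k))\<^sup>2) \<longlonglongrightarrow> 0"
      by (rule Lim_null_comparison[OF _ lim]) (simp add: that)
    from tendsto_real_sqrt[OF this] show ?thesis by simp
  qed
  show thesis
  proof (rule that[OF test])
    show "(\<lambda>k. L2_norm \<Omega> (\<lambda>x. u x - \<psi> k x)) \<longlonglongrightarrow> 0"
      by (rule part) (simp add: sum_nonneg)
    show "(\<lambda>k. L2_norm \<Omega> (\<lambda>x. grad \<Omega> u x $ i - partial_deriv i (\<psi> k) x)) \<longlonglongrightarrow> 0" for i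
    proof (rule part)
      fix k
      have "?q k i \<le> (\<Sum>i\<in>UNIV. ?q k i)" by (rule member_le_sum) auto
      then show "?q k i \<le> ?p k + (\<Sum>i\<in>UNIV. ?q k i)" by (simp add: add_increasing)
    qed
  qed
qed

lemma H10_if_approximation:
  assumes "u \<in> H1 \<Omega>" "\<And>k :: nat. \<psi> k \<in> test_functions \<Omega>"
    and "(\<lambda>k. L2_norm \<Omega> (\<lambda>x. u x - \<psi> k x)) \<longlonglongrightarrow> 0"
    and "\<And>i. (\<lambda>k. L2_norm \<Omega> (\<lambda>x. grad \<Omega> u x $ i - partial_deriv i (\<psi> k) x)) \<longlonglongrightarrow> 0"
  shows "u \<in> H10 \<Omega>"
proof -
  have "(\<lambda>k. (L2_norm \<Omega> (\<lambda>x. u x - \<psi> k x))\<^sup>2 +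
      (\<Sum>i\<in>UNIV. (L2_norm \<Omega> (\<lambda>x. grad \<Omega> u x $ i - partial_deriv i (\<psi> k) x))\<^sup>2))
      \<longlonglongrightarrow> 0\<^sup>2 + (\<Sum>i\<in>(UNIV :: 'd set). 0\<^sup>2)"
    by (intro tendsto_intros assms(3,4))
  then show ?thesis
    using assms(1,2) unfolding H10_def mem_Collect_eq
    by (intro conjI exI[of _ \<psi>] allI) (simp_all add: H1_distance_eq)
qed

lemma H10_lincomb:
  assumes "u \<in> H10 \<Omega>" "v \<in> H10 \<Omega>"
  shows "(\<lambda>x. u x + c * v x) \<in> H10 \<Omega>"
proof -
  note H1s = assms[THEN H10_H1]
  obtain \<psi> where \<psi>: "\<And>k. \<psi> k \<in> test_functions \<Omega>"
    "(\<lambda>k. L2_norm \<Omega> (\<lambda>x. u x - \<psi> k x)) \<longlonglongrightarrow> 0"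
    "\<And>i. (\<lambda>k. L2_norm \<Omega> (\<lambda>x. grad \<Omega> u x $ i - partial_deriv i (\<psi> k) x)) \<longlonglongrightarrow> 0"
    using H10_approximation[OF assms(1)] by blast
  obtain \<xi> where \<xi>: "\<And>k. \<xi> k \<in> test_functions \<Omega>"
    "(\<lambda>k. L2_norm \<Omega> (\<lambda>x. v x - \<xi> k x)) \<longlonglongrightarrow> 0"
    "\<And>i. (\<lambda>k. L2_norm \<Omega> (\<lambda>x. grad \<Omega> v x $ i - partial_deriv i (\<xi> k) x)) \<longlonglongrightarrow> 0"
    using H10_approximation[OF assms(2)] by blast
  \<comment> \<open>Needed twice: for the functions themselves and for each of their partial derivatives.\<close>
  have null: "(\<lambda>k. L2_norm \<Omega> (p k)) \<longlonglongrightarrow> 0"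
    if "(\<lambda>k. L2_norm \<Omega> (\<lambda>x. p1 x - q1 k x)) \<longlonglongrightarrow> 0" "(\<lambda>k. L2_norm \<Omega> (\<lambda>x. p2 x - q2 k x)) \<longlonglongrightarrow> 0"
      and "p1 \<in> L2 \<Omega>" "p2 \<in> L2 \<Omega>" "\<And>k. q1 k \<in> L2 \<Omega>" "\<And>k. q2 k \<in> L2 \<Omega>"
      and "\<And>k. p k \<in> L2 \<Omega>"
      and "\<And>k. AE x in lebesgue_on \<Omega>. p k x = (p1 x - q1 k x) + c * (p2 x - q2 k x)"
    for p :: "nat \<Rightarrow> real ^ 'd \<Rightarrow> real" and p1 p2 q1 q2
  proof (rule Lim_null_comparison)
    have "L2_norm \<Omega> (p k) \<le> L2_norm \<Omega> (\<lambda>x. p1 x - q1 k x) + \<bar>c\<bar> * L2_norm \<Omega> (\<lambda>x. p2 x - q2 k x)" for k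
    proof -
      have d: "(\<lambda>x. p1 x - q1 k x) \<in> L2 \<Omega>" "(\<lambda>x. p2 x - q2 k x) \<in> L2 \<Omega>"
        by (intro L2_diff that)+
      show ?thesis
        using L2_norm_lincomb_le[OF d, of c] L2_norm_cong_AE[OF that(8,7) L2_lincomb[OF d, of c]]
        by simp
    qed
    then show "\<forall>\<^sub>F k in sequentially. norm (L2_norm \<Omega> (p k))
        \<le> L2_norm \<Omega> (\<lambda>x. p1 x - q1 k x) + \<bar>c\<bar> * L2_norm \<Omega> (\<lambda>x. p2 x - q2 k x)"
      by simp
    have "(\<lambda>k. L2_norm \<Omega> (\<lambda>x. p1 x - q1 k x) + \<bar>c\<bar> * L2_norm \<Omega> (\<lambda>x. p2 x - q2 k x))
        \<longlonglongrightarrow> 0 + \<bar>c\<bar> * 0"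
      by (intro tendsto_intros that)
    then show "(\<lambda>k. L2_norm \<Omega> (\<lambda>x. p1 x - q1 k x) + \<bar>c\<bar> * L2_norm \<Omega> (\<lambda>x. p2 x - q2 k x)) \<longlonglongrightarrow> 0"
      by simp
  qed
  note L2s = H1s[THEN has_weak_gradient_grad, THEN has_weak_gradient_component_L2]
  note uv = H1_lincomb[OF H1s, of c]
  note test = test_functions_lincomb[OF \<psi>(1) \<xi>(1), where c = c]
  show ?thesis
  proof (rule H10_if_approximation[OF uv, of "\<lambda>k x. \<psi> k x + c * \<xi> k x"])
    show "(\<lambda>x. \<psi> k x + c * \<xi> k x) \<in> test_functions \<Omega>" for k by (rule test)
    show "(\<lambda>k. L2_norm \<Omega> (\<lambda>x. u x + c * v x - (\<psi> k x + c * \<xi> k x))) \<longlonglongrightarrow> 0"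
    proof (rule null[OF \<psi>(2) \<xi>(2)])
      show "(\<lambda>x. u x + c * v x - (\<psi> k x + c * \<xi> k x)) \<in> L2 \<Omega>" for k
        by (rule L2_diff[OF H1_L2[OF uv] test_L2[OF test]])
      show "AE x in lebesgue_on \<Omega>. u x + c * v x - (\<psi> k x + c * \<xi> k x) =
          u x - \<psi> k x + c * (v x - \<xi> k x)" for k
        by (rule AE_I2) (simp add: algebra_simps)
    qed (auto simp: assms H10_L2 test_L2 \<psi>(1) \<xi>(1))
    show "(\<lambda>k. L2_norm \<Omega> (\<lambda>x. grad \<Omega> (\<lambda>x. u x + c * v x) x $ i
        - partial_deriv i (\<lambda>x. \<psi> k x + c * \<xi> k x) x)) \<longlonglongrightarrow> 0" for i
    proof (rule null[OF \<psi>(3) \<xi>(3), of _ i])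
      show "(\<lambda>x. grad \<Omega> (\<lambda>x. u x + c * v x) x $ i
          - partial_deriv i (\<lambda>x. \<psi> k x + c * \<xi> k x) x) \<in> L2 \<Omega>" for k
        by (rule L2_diff[OF has_weak_gradient_component_L2[OF has_weak_gradient_grad[OF uv]]
              partial_L2[OF test]])
      have partial: "partial_deriv i (\<lambda>x. \<psi> k x + c * \<xi> k x) x
          = partial_deriv i (\<psi> k) x + c * partial_deriv i (\<xi> k) x" for k x
      proof -
        have s: "smooth (\<psi> k)" "smooth (\<xi> k)" "smooth (\<lambda>x. c * \<xi> k x)"
          using \<psi>(1)[of k] \<xi>(1)[of k] by (auto simp: test_functions_def smooth_mult smooth_const)
        show ?thesis
          using partial_deriv_add[OF s(1,3)[THEN smooth_differentiable]]
            partial_deriv_mult[OF smooth_const[THEN smooth_differentiable] s(2)[THEN smooth_differentiable]]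
          by (simp add: partial_deriv_const)
      qed
      show "AE x in lebesgue_on \<Omega>. grad \<Omega> (\<lambda>x. u x + c * v x) x $ i
          - partial_deriv i (\<lambda>x. \<psi> k x + c * \<xi> k x) x
        = grad \<Omega> u x $ i - partial_deriv i (\<psi> k) x + c * (grad \<Omega> v x $ i - partial_deriv i (\<xi> k) x)" for k
        using grad_lincomb_AE[OF H1s, of c] by eventually_elim (simp add: partial algebra_simps)
    qed (auto simp: L2s partial_L2 \<psi>(1) \<xi>(1))
  qed
qed

lemma H10_cong_AE:
  assumes "u \<in> H10 \<Omega>" "v \<in> L2 \<Omega>" "AE x in lebesgue_on \<Omega>. u x = v x"
  shows "v \<in> H10 \<Omega>"
proof -
  note u = H10_L2[OF assms(1)]
  obtain \<psi> where \<psi>: "\<And>k. \<psi> k \<in> test_functions \<Omega>"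
    "(\<lambda>k. L2_norm \<Omega> (\<lambda>x. u x - \<psi> k x)) \<longlonglongrightarrow> 0"
    "\<And>i. (\<lambda>k. L2_norm \<Omega> (\<lambda>x. grad \<Omega> u x $ i - partial_deriv i (\<psi> k) x)) \<longlonglongrightarrow> 0"
    using H10_approximation[OF assms(1)] by blast
  show ?thesis
  proof (rule H10_if_approximation[OF _ \<psi>(1)])
    show "v \<in> H1 \<Omega>"
      using H10_H1[OF assms(1)] assms(2) has_weak_gradient_cong_AE[OF u assms(2,3)]
      by (simp add: H1_def)
    have "L2_norm \<Omega> (\<lambda>x. u x - \<psi> k x) = L2_norm \<Omega> (\<lambda>x. v x - \<psi> k x)" for k
    proof (rule L2_norm_cong_AE)
      show "AE x in lebesgue_on \<Omega>. u x - \<psi> k x = v x - \<psi> k x"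
        using assms(3) by eventually_elim simp
    qed (intro L2_diff u assms(2) test_L2[OF \<psi>(1)])+
    then show "(\<lambda>k. L2_norm \<Omega> (\<lambda>x. v x - \<psi> k x)) \<longlonglongrightarrow> 0" using \<psi>(2) by simp
    show "(\<lambda>k. L2_norm \<Omega> (\<lambda>x. grad \<Omega> v x $ i - partial_deriv i (\<psi> k) x)) \<longlonglongrightarrow> 0" for i
      using \<psi>(3)[of i] grad_cong_AE[OF u assms(2,3)] by simp
  qed
qed

lemma H10_diff: "u \<in> H10 \<Omega> \<Longrightarrow> v \<in> H10 \<Omega> \<Longrightarrow> (\<lambda>x. u x - v x) \<in> H10 \<Omega>"
  using H10_lincomb[of u v "-1"] by simp

lemma H10_zero: "(\<lambda>x. 0) \<in> H10 \<Omega>"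
proof -
  have test: "(\<lambda>x. 0) \<in> test_functions \<Omega>" by (simp add: test_functions_def smooth_const)
  have weak: "has_weak_gradient \<Omega> (\<lambda>x. 0) (\<lambda>x. 0)"
    by (simp add: has_weak_gradient_def L2_inner_def)
  then have H1: "(\<lambda>x. 0) \<in> H1 \<Omega>" unfolding H1_def by auto
  have "L2_norm \<Omega> (\<lambda>x. grad \<Omega> (\<lambda>x. 0) x $ i - 0) = L2_norm \<Omega> (\<lambda>x. 0)" for i
  proof (rule L2_norm_cong_AE)
    show "AE x in lebesgue_on \<Omega>. grad \<Omega> (\<lambda>x. 0) x $ i - 0 = 0"
      using weak_gradient_unique[OF has_weak_gradient_grad[OF H1] weak]
      by eventually_elim simp
  qed (use has_weak_gradient_component_L2[OF has_weak_gradient_grad[OF H1]] in auto)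
  then show ?thesis
    by (intro H10_if_approximation[OF H1, of "\<lambda>k x. 0"] test)
       (simp_all add: partial_deriv_const L2_norm_def L2_inner_def)
qed

lemma H10_sum:
  "(\<And>i. i \<in> I \<Longrightarrow> v i \<in> H10 \<Omega>) \<Longrightarrow> (\<lambda>x. \<Sum>i\<in>I. c i * v i x) \<in> H10 \<Omega>"
proof (induction I rule: infinite_finite_induct)
  case (insert i I)
  then show ?case
    using H10_lincomb[of "\<lambda>x. \<Sum>i\<in>I. c i * v i x" "v i" "c i"] by (simp add: add.commute)
qed (simp_all add: H10_zero)

lemma grad_inner_sum:
  assumes w: "w \<in> H10 \<Omega>"
  shows "(\<And>i. i \<in> I \<Longrightarrow> v i \<in> H10 \<Omega>) \<Longrightarrow>
    grad_inner \<Omega> (\<lambda>x. \<Sum>i\<in>I. c i * v i x) w = (\<Sum>i\<in>I. c i * grad_inner \<Omega> (v i) w)"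
proof (induction I rule: infinite_finite_induct)
  case (insert i I)
  then show ?case
    using grad_inner_lincomb[OF H10_sum[of I v c, THEN H10_H1] H10_H1[of "v i"] H10_H1[OF w], of "c i"]
    by (simp add: add.commute)
next
  case empty
  show ?case using grad_inner_lincomb[OF H10_zero[THEN H10_H1] H10_zero[THEN H10_H1] H10_H1[OF w], of 1]
    by simp
next
  case (infinite I)
  show ?case using infinite grad_inner_lincomb[OF H10_zero[THEN H10_H1] H10_zero[THEN H10_H1] H10_H1[OF w], of 1]
    by simp
qed

text \<open>
  Let \<open>\<psi>\<^sub>k \<rightarrow> u\<close> in \<open>H\<^sup>1\<close> with test functions \<open>\<psi>\<^sub>k\<close>. The function \<open>x\<^sub>i \<psi>\<^sub>k\<close> is again a test function, and
  \<open>\<partial>\<^sub>i (x\<^sub>i \<psi>\<^sub>k) = \<psi>\<^sub>k + x\<^sub>i \<partial>\<^sub>i \<psi>\<^sub>k\<close>. As the weak gradient of \<open>u\<close> vanishes, \<open>(u, \<psi>\<^sub>k + x\<^sub>i \<partial>\<^sub>i \<psi>\<^sub>k) = 0\<close>. The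
  coordinate \<open>x\<^sub>i\<close> is bounded on \<open>\<Omega>\<close> and \<open>\<partial>\<^sub>i \<psi>\<^sub>k \<rightarrow> 0\<close> in \<open>L\<^sup>2\<close>, so in the limit \<open>(u, u) = 0\<close>.
\<close>

lemma H10_eq_0_if_gradient_eq_0:
  assumes u: "u \<in> H10 \<Omega>" and zero: "grad_inner \<Omega> u u = 0"
  shows "AE x in lebesgue_on \<Omega>. u x = 0"
proof -
  \<comment> \<open>Any coordinate direction will do; there is one because index types are nonempty.\<close>
  fix i :: 'd
  note gL2 = has_weak_gradient_component_L2[OF has_weak_gradient_grad[OF H10_H1[OF u]]]
  have "L2_inner \<Omega> (\<lambda>x. grad \<Omega> u x $ i) (\<lambda>x. grad \<Omega> u x $ i) = 0"
    using zero unfolding grad_inner_eq_sum[OF H10_H1[OF u] H10_H1[OF u]]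
    by (subst (asm) sum_nonneg_eq_0_iff) (auto simp: L2_inner_self_nonneg)
  then have g0: "AE x in lebesgue_on \<Omega>. grad \<Omega> u x $ i = 0"
    by (simp add: L2_inner_self_eq_0_iff[OF gL2])
  obtain \<psi> where \<psi>: "\<And>k. \<psi> k \<in> test_functions \<Omega>"
    "(\<lambda>k. L2_norm \<Omega> (\<lambda>x. u x - \<psi> k x)) \<longlonglongrightarrow> 0"
    "\<And>i. (\<lambda>k. L2_norm \<Omega> (\<lambda>x. grad \<Omega> u x $ i - partial_deriv i (\<psi> k) x)) \<longlonglongrightarrow> 0"
    using H10_approximation[OF u] by blast
  obtain B where B: "\<And>x. x \<in> \<Omega> \<Longrightarrow> \<bar>x $ i\<bar> \<le> B"
    using bounded_\<Omega> unfolding bounded_iff by (meson component_le_norm_cart order_trans)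
  have coord: "(\<lambda>x. x $ i) \<in> borel_measurable (lebesgue_on \<Omega>)"
    using open_\<Omega> by (intro continuous_imp_measurable_on_sets_lebesgue continuous_intros) simp_all
  have xu: "(\<lambda>x. x $ i * u x) \<in> L2 \<Omega>"
    by (rule L2_times_bounded[OF H10_L2[OF u] coord B])
  have zero: "L2_inner \<Omega> (\<psi> k) u + L2_inner \<Omega> (partial_deriv i (\<psi> k)) (\<lambda>x. x $ i * u x) = 0" for k
  proof -
    let ?\<psi> = "\<lambda>x. x $ i * \<psi> k x"
    have test: "?\<psi> \<in> test_functions \<Omega>"
      by (rule test_functions_smooth_mult[OF smooth_coordinate \<psi>(1)])
    have "L2_inner \<Omega> u (partial_deriv i ?\<psi>) = - L2_inner \<Omega> (\<lambda>x. grad \<Omega> u x $ i) ?\<psi>"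
      by (rule has_weak_gradientD[OF has_weak_gradient_grad[OF H10_H1[OF u]] test])
    also have "\<dots> = 0"
      using L2_inner_cong_AE[OF g0 gL2 L2_zero test_L2[OF test]] by (simp add: L2_inner_def)
    finally have "L2_inner \<Omega> u (partial_deriv i ?\<psi>) = 0" .
    moreover have "partial_deriv i ?\<psi> = (\<lambda>x. x $ i * partial_deriv i (\<psi> k) x + \<psi> k x)"
      using \<psi>(1)[of k]
      by (intro ext)
         (simp add: test_functions_def partial_deriv_mult smooth_differentiable smooth_coordinate
           partial_deriv_coordinate)
    moreover have "L2_inner \<Omega> u (\<lambda>x. x $ i * partial_deriv i (\<psi> k) x + \<psi> k x)
        = L2_inner \<Omega> (\<lambda>x. x $ i * partial_deriv i (\<psi> k) x) u + L2_inner \<Omega> (\<psi> k) u"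
      using L2_inner_lincomb[OF L2_times_bounded[OF partial_L2[OF \<psi>(1)[of k], of i] coord B]
          test_L2[OF \<psi>(1)[of k]] H10_L2[OF u], where c = 1]
      by (simp add: L2_inner_commute[of _ u])
    ultimately show ?thesis by (simp add: L2_inner_def mult.assoc mult.left_commute)
  qed
  have "(\<lambda>k. L2_inner \<Omega> (\<psi> k) u + L2_inner \<Omega> (partial_deriv i (\<psi> k)) (\<lambda>x. x $ i * u x))
      \<longlonglongrightarrow> L2_inner \<Omega> u u + L2_inner \<Omega> (\<lambda>x. grad \<Omega> u x $ i) (\<lambda>x. x $ i * u x)"
    by (intro tendsto_add L2_inner_tendsto H10_L2[OF u] xu test_L2 partial_L2 \<psi> gL2)
  then have "L2_inner \<Omega> u u + L2_inner \<Omega> (\<lambda>x. grad \<Omega> u x $ i) (\<lambda>x. x $ i * u x) = 0"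
    by (simp add: zero LIMSEQ_const_iff)
  moreover have "L2_inner \<Omega> (\<lambda>x. grad \<Omega> u x $ i) (\<lambda>x. x $ i * u x) = 0"
    using L2_inner_cong_AE[OF g0 gL2 L2_zero xu] by (simp add: L2_inner_def)
  ultimately show ?thesis
    by (simp add: L2_inner_self_eq_0_iff[OF H10_L2[OF u]])
qed

end

section \<open>Finite-dimensional subspaces\<close>

lemma fun_span_L2: "w \<in> fun_span \<Omega> I b \<Longrightarrow> w \<in> L2 \<Omega>"
  by (simp add: fun_span_def)

lemma fun_spanI:
  "w \<in> L2 \<Omega> \<Longrightarrow> AE x in lebesgue_on \<Omega>. w x = (\<Sum>i\<in>I. c i * b i x) \<Longrightarrow> w \<in> fun_span \<Omega> I b"
  by (auto simp: fun_span_def)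

lemma fun_spanE:
  assumes "w \<in> fun_span \<Omega> I b"
  obtains c where "AE x in lebesgue_on \<Omega>. w x = (\<Sum>i\<in>I. c i * b i x)"
  using assms by (auto simp: fun_span_def)

lemma fun_span_lincomb:
  assumes "v \<in> fun_span \<Omega> I b" "w \<in> fun_span \<Omega> I b"
  shows "(\<lambda>x. v x + c * w x) \<in> fun_span \<Omega> I b"
proof -
  obtain p where p: "AE x in lebesgue_on \<Omega>. v x = (\<Sum>i\<in>I. p i * b i x)"
    by (rule fun_spanE[OF assms(1)])
  obtain q where q: "AE x in lebesgue_on \<Omega>. w x = (\<Sum>i\<in>I. q i * b i x)"
    by (rule fun_spanE[OF assms(2)])
  from p q have "AE x in lebesgue_on \<Omega>. v x + c * w x = (\<Sum>i\<in>I. (p i + c * q i) * b i x)"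
    by eventually_elim (simp add: sum.distrib sum_distrib_left distrib_right mult.assoc)
  then show ?thesis by (rule fun_spanI[OF L2_lincomb[OF assms[THEN fun_span_L2]]])
qed

lemma fun_span_diff:
  "v \<in> fun_span \<Omega> I b \<Longrightarrow> w \<in> fun_span \<Omega> I b \<Longrightarrow> (\<lambda>x. v x - w x) \<in> fun_span \<Omega> I b"
  using fun_span_lincomb[of v \<Omega> I b w "-1"] by simp

lemma fun_span_zero: "(\<lambda>x. 0) \<in> fun_span \<Omega> I b"
  by (rule fun_spanI[where c = "\<lambda>i. 0"]) simp_all

lemma fun_span_sum:
  "(\<And>j. j \<in> J \<Longrightarrow> v j \<in> fun_span \<Omega> I b) \<Longrightarrow> (\<lambda>x. \<Sum>j\<in>J. c j * v j x) \<in> fun_span \<Omega> I b"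
proof (induction J rule: infinite_finite_induct)
  case (insert j J)
  then show ?case
    using fun_span_lincomb[of "\<lambda>x. \<Sum>j\<in>J. c j * v j x" \<Omega> I b "v j" "c j"]
    by (simp add: add.commute)
qed (simp_all add: fun_span_zero)

lemma fun_span_cong_AE:
  assumes "v \<in> fun_span \<Omega> I b" "w \<in> L2 \<Omega>" "AE x in lebesgue_on \<Omega>. w x = v x"
  shows "w \<in> fun_span \<Omega> I b"
proof -
  obtain p where p: "AE x in lebesgue_on \<Omega>. v x = (\<Sum>i\<in>I. p i * b i x)"
    by (rule fun_spanE[OF assms(1)])
  from assms(3) p have "AE x in lebesgue_on \<Omega>. w x = (\<Sum>i\<in>I. p i * b i x)"
    by eventually_elim simp
  then show ?thesis by (rule fun_spanI[OF assms(2)])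
qed

lemma fun_span_basis:
  assumes "finite I" "i \<in> I" "b i \<in> L2 \<Omega>"
  shows "b i \<in> fun_span \<Omega> I b"
proof (rule fun_spanI[OF assms(3)])
  have "(\<Sum>j\<in>I. (if j = i then 1 else 0) * b j x) = (\<Sum>j\<in>I. if j = i then b j x else 0)" for x
    by (rule sum.cong) auto
  then show "AE x in lebesgue_on \<Omega>. b i x = (\<Sum>j\<in>I. (if j = i then 1 else 0) * b j x)"
    using assms(1,2) by simp
qed

lemma fun_span_subset:
  assumes "\<And>i. i \<in> J \<Longrightarrow> b i \<in> fun_span \<Omega> I d"
  shows "fun_span \<Omega> J b \<subseteq> fun_span \<Omega> I d"
proof
  fix w assume w: "w \<in> fun_span \<Omega> J b"
  then obtain p where "AE x in lebesgue_on \<Omega>. w x = (\<Sum>i\<in>J. p i * b i x)"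
    by (rule fun_spanE)
  from fun_span_cong_AE[OF fun_span_sum[OF assms] fun_span_L2[OF w] this]
  show "w \<in> fun_span \<Omega> I d" .
qed

lemma (in bounded_open_set) conforming_space_subset_H10:
  assumes "conforming_space \<Omega> W"
  shows "W \<subseteq> H10 \<Omega>"
proof
  fix w assume "w \<in> W"
  obtain m b where b: "\<And>j. j \<in> {1..m} \<Longrightarrow> b j \<in> H10 \<Omega>" and W: "W = fun_span \<Omega> {1..m} b"
    using assms unfolding conforming_space_def by blast
  have w: "w \<in> fun_span \<Omega> {1..m} b" using \<open>w \<in> W\<close> W by simp
  then obtain p where p: "AE x in lebesgue_on \<Omega>. w x = (\<Sum>i\<in>{1..m}. p i * b i x)"
    by (rule fun_spanE)
  have "AE x in lebesgue_on \<Omega>. (\<Sum>i\<in>{1..m}. p i * b i x) = w x"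
    using p by eventually_elim simp
  from H10_cong_AE[OF H10_sum[OF b] fun_span_L2[OF w] this] show "w \<in> H10 \<Omega>" .
qed

section \<open>Expansion of the snapshots in POD modes\<close>

text \<open>
  An orthonormal family with as many members as the dimension is complete, here in the form that the
  transpose of a square matrix with orthonormal rows is orthonormal too. Bessel's inequality for the
  coordinate vector \<open>e\<^sub>j\<close> says \<open>B j \<le> 1\<close>. Summed over \<open>j\<close>, the left-hand sides give the number of
  family members, and the right-hand sides the number of coordinates. These agree, so each
  inequality is an equality and each \<open>e\<^sub>j\<close> equals its expansion in the family.
\<close>

lemma weighted_orthonormal_complete:
  fixes F :: "'i \<Rightarrow> 'j \<Rightarrow> real" and w :: "'j \<Rightarrow> real"
  assumes fin: "finite I" "finite J" and card: "card I = card J"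
    and w: "\<And>j. j \<in> J \<Longrightarrow> w j > 0"
    and ortho: "\<And>i l. i \<in> I \<Longrightarrow> l \<in> I \<Longrightarrow> (\<Sum>j\<in>J. w j * F i j * F l j) = (if i = l then 1 else 0)"
    and jk: "j \<in> J" "k \<in> J"
  shows "(\<Sum>i\<in>I. w k * F i j * F i k) = (if j = k then 1 else 0)"
proof -
  define B where "B j = (\<Sum>i\<in>I. w j * (F i j)\<^sup>2)" for j
  \<comment> \<open>The defect between \<open>e\<^sub>j\<close> and its expansion; its norm is computed from \<open>B j\<close>.\<close>
  define e where "e j k = (if j = k then 1 else 0 :: real) - (\<Sum>i\<in>I. w j * F i j * F i k)" for j k
  have defect: "(\<Sum>k\<in>J. w k * (e j k)\<^sup>2) = w j * (1 - B j)" if j: "j \<in> J" for j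
  proof -
    let ?p = "\<lambda>k. \<Sum>i\<in>I. w j * F i j * F i k"
    have "(\<Sum>k\<in>J. w k * (e j k)\<^sup>2)
        = (\<Sum>k\<in>J. if k = j then w k - 2 * w k * ?p k else 0) + (\<Sum>k\<in>J. w k * (?p k * ?p k))"
      unfolding sum.distrib[symmetric]
      by (rule sum.cong) (auto simp: e_def power2_eq_square algebra_simps)
    also have "(\<Sum>k\<in>J. if k = j then w k - 2 * w k * ?p k else 0) = w j - 2 * w j * ?p j"
      using j fin by simp
    also have "?p j = B j"
      by (simp add: B_def power2_eq_square mult.assoc)
    also have "(\<Sum>k\<in>J. w k * (?p k * ?p k)) = w j * B j"
    proof -
      have "(\<Sum>k\<in>J. w k * (?p k * ?p k))
          = (\<Sum>k\<in>J. \<Sum>i\<in>I. \<Sum>l\<in>I. w k * ((w j * F i j * F i k) * (w j * F l j * F l k)))"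
        by (intro sum.cong refl, subst sum_product, simp only: sum_distrib_left)
      also have "\<dots> = (\<Sum>i\<in>I. \<Sum>k\<in>J. \<Sum>l\<in>I. w k * ((w j * F i j * F i k) * (w j * F l j * F l k)))"
        by (rule sum.swap)
      also have "\<dots> = (\<Sum>i\<in>I. \<Sum>l\<in>I. \<Sum>k\<in>J. w k * ((w j * F i j * F i k) * (w j * F l j * F l k)))"
        by (intro sum.cong refl sum.swap)
      also have "\<dots> = (\<Sum>i\<in>I. \<Sum>l\<in>I. (w j * F i j) * (w j * F l j) * (\<Sum>k\<in>J. w k * F i k * F l k))"
        by (simp add: sum_distrib_left algebra_simps)
      also have "\<dots> = (\<Sum>i\<in>I. \<Sum>l\<in>I. if i = l then (w j * F i j) * (w j * F l j) else 0)"
        by (intro sum.cong refl) (simp add: ortho)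
      also have "\<dots> = (\<Sum>i\<in>I. (w j * F i j) * (w j * F i j))"
        using fin by simp
      finally show ?thesis by (simp add: B_def sum_distrib_left power2_eq_square algebra_simps)
    qed
    finally show ?thesis by (simp add: algebra_simps)
  qed
  have B_le: "B j \<le> 1" if "j \<in> J" for j
  proof -
    have "0 \<le> w j * (1 - B j)"
      unfolding defect[OF that, symmetric]
      by (intro sum_nonneg mult_nonneg_nonneg) (auto intro: less_imp_le w)
    then show ?thesis using w[OF that] by (simp add: zero_le_mult_iff)
  qed
  have "(\<Sum>j\<in>J. B j) = (\<Sum>i\<in>I. \<Sum>j\<in>J. w j * F i j * F i j)"
    unfolding B_def by (subst sum.swap) (simp add: power2_eq_square mult.assoc)
  also have "\<dots> = card J" using ortho card by simp
  finally have "(\<Sum>j\<in>J. 1 - B j) = 0" by (simp add: sum_subtractf)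
  then have "1 - B j = 0" using B_le jk(1) fin
    by (subst (asm) sum_nonneg_eq_0_iff) auto
  then have "(\<Sum>k\<in>J. w k * (e j k)\<^sup>2) = 0" using defect[OF jk(1)] by simp
  then have "w k * (e j k)\<^sup>2 = 0"
    using jk(2) fin by (subst (asm) sum_nonneg_eq_0_iff) (auto intro!: mult_nonneg_nonneg less_imp_le[OF w])
  then have "e j k = 0" using w[OF jk(2)] by auto
  then have p: "(\<Sum>i\<in>I. w j * F i j * F i k) = (if j = k then 1 else 0)" by (simp add: e_def)
  have "w j * (\<Sum>i\<in>I. w k * F i j * F i k) = w k * (\<Sum>i\<in>I. w j * F i j * F i k)"
    by (simp add: sum_distrib_left algebra_simps)
  then show ?thesis using p w[OF jk(1)] by (auto split: if_splits)
qed

text \<open>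
  The initial value and the difference quotients play the same role in \<open>K1\<close>. Numbering them
  consecutively, with the weights of the inner product of \<open>S\<close>, turns \<open>K1\<close> and \<open>S_inner\<close> into
  weighted sums over \<open>{1..N}\<close>.
\<close>

definition S_weight :: "real \<Rightarrow> nat \<Rightarrow> nat \<Rightarrow> real" where
  "S_weight T N j = (if j = 1 then 1 else time_step T N)"

definition snapshot ::
    "real \<Rightarrow> nat \<Rightarrow> (nat \<Rightarrow> real ^ 'd \<Rightarrow> real) \<Rightarrow> nat \<Rightarrow> (real ^ 'd \<Rightarrow> real)" where
  "snapshot T N u j = (if j = 1 then u 1 else diff_quot T N u (j - 1))"

lemma sum_split_first:
  fixes h :: "nat \<Rightarrow> real"
  assumes "N \<ge> 1"
  shows "(\<Sum>j = 1..N. h j) = h 1 + (\<Sum>j = 2..N. h j)"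
  using sum.atLeast_Suc_atMost[of 1 N h] assms by (simp add: numeral_2_eq_2)

lemma S_inner_eq_sum:
  assumes "N \<ge> 1"
  shows "S_inner T N g h = (\<Sum>j = 1..N. S_weight T N j * g j * h j)"
proof -
  have "(\<Sum>j = 2..N. S_weight T N j * g j * h j) = time_step T N * (\<Sum>j = 2..N. g j * h j)"
    by (simp add: S_weight_def sum_distrib_left mult.assoc)
  then show ?thesis
    unfolding S_inner_def sum_split_first[OF assms] by (simp add: S_weight_def)
qed

lemma K1_eq_sum:
  assumes "N \<ge> 1"
  shows "K1 T N u g x = (\<Sum>j = 1..N. S_weight T N j * g j * snapshot T N u j x)"
proof -
  have "(\<Sum>j = 2..N. S_weight T N j * g j * snapshot T N u j x)
      = (\<Sum>j = 1..<N. time_step T N * g (j + 1) * diff_quot T N u j x)"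
    by (rule sum.reindex_bij_witness[of _ "\<lambda>j. j + 1" "\<lambda>j. j - 1"])
       (auto simp: S_weight_def snapshot_def)
  then show ?thesis
    unfolding K1_def sum_split_first[OF assms] by (simp add: S_weight_def snapshot_def)
qed

lemma time_step_pos: "T > 0 \<Longrightarrow> N \<ge> 2 \<Longrightarrow> time_step T N > 0"
  by (simp add: time_step_def)

lemma S_weight_pos: "T > 0 \<Longrightarrow> N \<ge> 2 \<Longrightarrow> S_weight T N j > 0"
  by (simp add: S_weight_def time_step_pos)

lemma pod_svd_orthonormal:
  assumes "is_pod_svd \<Omega> T N u ev F \<phi>" "N \<ge> 1" "i \<in> {1..N}" "l \<in> {1..N}"
  shows "(\<Sum>j = 1..N. S_weight T N j * F i j * F l j) = (if i = l then 1 else 0)"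
  using assms S_inner_eq_sum[OF assms(2), of T "F i" "F l"] by (simp add: is_pod_svd_def)

lemma pod_svd_L2: "is_pod_svd \<Omega> T N u ev F \<phi> \<Longrightarrow> i \<ge> 1 \<Longrightarrow> \<phi> i \<in> L2 \<Omega>"
  by (simp add: is_pod_svd_def)

lemma pod_svd_nonneg: "is_pod_svd \<Omega> T N u ev F \<phi> \<Longrightarrow> i \<ge> 1 \<Longrightarrow> ev i \<ge> 0"
  by (simp add: is_pod_svd_def)

lemma pod_svd_K1:
  "is_pod_svd \<Omega> T N u ev F \<phi> \<Longrightarrow> i \<in> {1..N} \<Longrightarrow>
    AE x in lebesgue_on \<Omega>. K1 T N u (F i) x = sqrt (ev i) * \<phi> i x"
  by (simp add: is_pod_svd_def)

lemma pod_svd_positive_indices: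
  assumes svd: "is_pod_svd \<Omega> T N u ev F \<phi>"
  shows "{i. i \<ge> 1 \<and> ev i > 0} = {1..num_positive ev}" and "num_positive ev \<le> N"
proof -
  let ?P = "{i. i \<ge> 1 \<and> ev i > 0}"
  have sub: "?P \<subseteq> {1..N}"
    using svd unfolding is_pod_svd_def by (auto simp: not_less[symmetric])
  then have fin: "finite ?P" using finite_subset by blast
  have down: "j \<in> ?P" if "i \<in> ?P" "1 \<le> j" "j \<le> i" for i j
    using svd that unfolding is_pod_svd_def by (auto intro: less_le_trans)
  have ex: "\<exists>m. ?P = {1..m}"
  proof (cases "?P = {}")
    case True
    then show ?thesis by (intro exI[of _ 0]) simp
  next
    case False
    have "?P = {1..Max ?P}"
    proof (intro equalityI subsetI)
      show "j \<in> {1..Max ?P}" if "j \<in> ?P" for j using that Max_ge[OF fin that] by simp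
      show "j \<in> ?P" if "j \<in> {1..Max ?P}" for j
        using down[OF Max_in[OF fin False], of j] that by simp
    qed
    then show ?thesis ..
  qed
  then obtain m where m: "?P = {1..m}" ..
  then show P: "?P = {1..num_positive ev}" by (simp add: num_positive_def)
  have "card ?P \<le> N" using card_mono[OF _ sub] by simp
  then show "num_positive ev \<le> N" by (simp add: num_positive_def)
qed

text \<open>
  By completeness of the right singular vectors the coordinate vector \<open>e\<^sub>j\<close> is a combination of the
  \<open>F i\<close>; applying \<open>K1\<close> gives the snapshot on one side and the modes on the other. Indices with
  \<open>ev i = 0\<close> are left out on purpose: those modes need not lie in \<open>H\<^sub>0\<^sup>1\<close>, so the Ritz projection
  could not be applied to them.
\<close>

lemma snapshot_pod_expansion:
  assumes svd: "is_pod_svd \<Omega> T N u ev F \<phi>" and "T > 0" "N \<ge> 2" and j: "j \<in> {1..N}"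
  shows "AE x in lebesgue_on \<Omega>.
    snapshot T N u j x = (\<Sum>i = 1..num_positive ev. (sqrt (ev i) * F i j) * \<phi> i x)"
proof -
  note complete = weighted_orthonormal_complete[of "{1..N}" "{1..N}" "S_weight T N" F]
  have "AE x in lebesgue_on \<Omega>. \<forall>i\<in>{1..N}. K1 T N u (F i) x = sqrt (ev i) * \<phi> i x"
    by (intro AE_finite_allI pod_svd_K1[OF svd]) simp_all
  then show ?thesis
  proof eventually_elim
    case (elim x)
    have zero: "ev i = 0" if "i \<in> {1..N} - {1..num_positive ev}" for i
      using that pod_svd_positive_indices(1)[OF svd] pod_svd_nonneg[OF svd, of i]
      by (metis (mono_tags, lifting) Diff_iff atLeastAtMost_iff mem_Collect_eq order_less_le)
    have "(\<Sum>i = 1..num_positive ev. (sqrt (ev i) * F i j) * \<phi> i x)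
        = (\<Sum>i = 1..N. (sqrt (ev i) * F i j) * \<phi> i x)"
      by (rule sum.mono_neutral_left) (use zero pod_svd_positive_indices(2)[OF svd] in auto)
    also have "\<dots> = (\<Sum>i = 1..N. F i j * K1 T N u (F i) x)"
      using elim by (intro sum.cong) simp_all
    also have "\<dots> = (\<Sum>i = 1..N. \<Sum>k = 1..N. S_weight T N k * F i j * F i k * snapshot T N u k x)"
      using \<open>N \<ge> 2\<close> by (simp add: K1_eq_sum sum_distrib_left algebra_simps)
    also have "\<dots> = (\<Sum>k = 1..N. (\<Sum>i = 1..N. S_weight T N k * F i j * F i k) * snapshot T N u k x)"
      by (subst sum.swap) (simp add: sum_distrib_right)
    also have "\<dots> = (\<Sum>k = 1..N. if j = k then snapshot T N u k x else 0)"
    proof (intro sum.cong refl)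
      fix k assume k: "k \<in> {1..N}"
      have "(\<Sum>i = 1..N. S_weight T N k * F i j * F i k) = (if j = k then 1 else 0)"
        using assms k by (intro complete pod_svd_orthonormal[OF svd] S_weight_pos) simp_all
      then show "(\<Sum>i = 1..N. S_weight T N k * F i j * F i k) * snapshot T N u k x
          = (if j = k then snapshot T N u k x else 0)" by simp
    qed
    also have "\<dots> = snapshot T N u j x" using j by simp
    finally show ?case by simp
  qed
qed

lemma weighted_energy_of_orthonormal_combination:
  assumes fin: "finite I"
    and \<psi>: "\<And>i. i \<in> I \<Longrightarrow> \<psi> i \<in> L2 \<Omega>" and b: "\<And>j. j \<in> J \<Longrightarrow> b j \<in> L2 \<Omega>"
    and expansion: "\<And>j. j \<in> J \<Longrightarrow> AE x in lebesgue_on \<Omega>. b j x = (\<Sum>i\<in>I. (\<sigma> i * F i j) * \<psi> i x)"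
    and ortho: "\<And>i l. i \<in> I \<Longrightarrow> l \<in> I \<Longrightarrow> (\<Sum>j\<in>J. w j * F i j * F l j) = (if i = l then 1 else 0)"
  shows "(\<Sum>j\<in>J. w j * (L2_norm \<Omega> (b j))\<^sup>2) = (\<Sum>i\<in>I. (\<sigma> i)\<^sup>2 * (L2_norm \<Omega> (\<psi> i))\<^sup>2)"
proof -
  have norm: "(L2_norm \<Omega> (b j))\<^sup>2
      = (\<Sum>i\<in>I. \<Sum>l\<in>I. (\<sigma> i * F i j) * ((\<sigma> l * F l j) * L2_inner \<Omega> (\<psi> i) (\<psi> l)))" if j: "j \<in> J" for j
  proof -
    let ?s = "\<lambda>x. \<Sum>i\<in>I. (\<sigma> i * F i j) * \<psi> i x"
    have s: "?s \<in> L2 \<Omega>" by (rule L2_sum[OF \<psi>])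
    have "(L2_norm \<Omega> (b j))\<^sup>2 = L2_inner \<Omega> ?s ?s"
      by (simp add: L2_norm_cong_AE[OF expansion[OF j] b[OF j] s] L2_norm_square)
    also have "\<dots> = (\<Sum>i\<in>I. (\<sigma> i * F i j) * L2_inner \<Omega> (\<psi> i) ?s)"
      by (rule L2_inner_sum[OF s \<psi>])
    also have "\<dots> = (\<Sum>i\<in>I. (\<sigma> i * F i j) * (\<Sum>l\<in>I. (\<sigma> l * F l j) * L2_inner \<Omega> (\<psi> i) (\<psi> l)))"
    proof (intro sum.cong refl arg_cong2[where f = "(*)"])
      fix i assume i: "i \<in> I"
      show "L2_inner \<Omega> (\<psi> i) ?s = (\<Sum>l\<in>I. (\<sigma> l * F l j) * L2_inner \<Omega> (\<psi> i) (\<psi> l))"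
        using L2_inner_sum[OF \<psi>[OF i] \<psi>, where c = "\<lambda>l. \<sigma> l * F l j"]
        by (simp add: L2_inner_commute[of _ "\<psi> i"])
    qed
    finally show ?thesis by (simp add: sum_distrib_left)
  qed
  have "(\<Sum>j\<in>J. w j * (L2_norm \<Omega> (b j))\<^sup>2)
      = (\<Sum>j\<in>J. \<Sum>i\<in>I. \<Sum>l\<in>I. w j * ((\<sigma> i * F i j) * ((\<sigma> l * F l j) * L2_inner \<Omega> (\<psi> i) (\<psi> l))))"
    by (simp add: norm sum_distrib_left)
  also have "\<dots> = (\<Sum>i\<in>I. \<Sum>j\<in>J. \<Sum>l\<in>I. w j * ((\<sigma> i * F i j) * ((\<sigma> l * F l j) * L2_inner \<Omega> (\<psi> i) (\<psi> l))))"
    by (rule sum.swap)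
  also have "\<dots> = (\<Sum>i\<in>I. \<Sum>l\<in>I. \<Sum>j\<in>J. w j * ((\<sigma> i * F i j) * ((\<sigma> l * F l j) * L2_inner \<Omega> (\<psi> i) (\<psi> l))))"
    by (intro sum.cong refl sum.swap)
  also have "\<dots> = (\<Sum>i\<in>I. \<Sum>l\<in>I. \<sigma> i * \<sigma> l * L2_inner \<Omega> (\<psi> i) (\<psi> l) * (\<Sum>j\<in>J. w j * F i j * F l j))"
    by (simp add: sum_distrib_left algebra_simps)
  also have "\<dots> = (\<Sum>i\<in>I. \<Sum>l\<in>I. if i = l then \<sigma> i * \<sigma> l * L2_inner \<Omega> (\<psi> i) (\<psi> l) else 0)"
    by (intro sum.cong refl) (simp add: ortho)
  also have "\<dots> = (\<Sum>i\<in>I. (\<sigma> i)\<^sup>2 * (L2_norm \<Omega> (\<psi> i))\<^sup>2)"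
    using fin by (simp add: L2_norm_square) (simp add: power2_eq_square)
  finally show ?thesis .
qed

section \<open>Residuals of the Ritz projection\<close>

lemma diff_quot_eq_lincomb:
  "diff_quot T N z n = (\<lambda>x. (1 / time_step T N) * z (n + 1) x + (- 1 / time_step T N) * z n x)"
  by (rule ext) (simp add: diff_quot_def diff_divide_distrib)

lemma diff_quot_L2: "z (n + 1) \<in> L2 \<Omega> \<Longrightarrow> z n \<in> L2 \<Omega> \<Longrightarrow> diff_quot T N z n \<in> L2 \<Omega>"
  unfolding diff_quot_eq_lincomb by (intro L2_lincomb L2_scale)

lemma L2_inner_diff_quot:
  assumes "z (n + 1) \<in> L2 \<Omega>" "z n \<in> L2 \<Omega>" "v \<in> L2 \<Omega>"
  shows "L2_inner \<Omega> (diff_quot T N z n) v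
    = (L2_inner \<Omega> (z (n + 1)) v - L2_inner \<Omega> (z n) v) / time_step T N"
  unfolding diff_quot_eq_lincomb
    L2_inner_lincomb[OF L2_scale[OF assms(1)] assms(2,3)] L2_inner_scale
  by (simp add: diff_divide_distrib)

locale ritz_projection = bounded_open_set \<Omega> for \<Omega> :: "(real ^ 'd) set" +
  fixes I :: "nat set" and b :: "nat \<Rightarrow> real ^ 'd \<Rightarrow> real"
    and R :: "(real ^ 'd \<Rightarrow> real) \<Rightarrow> (real ^ 'd \<Rightarrow> real)"
  assumes span_H10: "fun_span \<Omega> I b \<subseteq> H10 \<Omega>"
    and ritz: "is_ritz_projection \<Omega> (fun_span \<Omega> I b) R"
begin

abbreviation W where "W \<equiv> fun_span \<Omega> I b"

lemma R_in_W: "w \<in> H10 \<Omega> \<Longrightarrow> R w \<in> W"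
  using ritz by (simp add: is_ritz_projection_def)

lemma R_H10: "w \<in> H10 \<Omega> \<Longrightarrow> R w \<in> H10 \<Omega>"
  using R_in_W span_H10 by blast

lemma residual_H10: "w \<in> H10 \<Omega> \<Longrightarrow> (\<lambda>x. w x - R w x) \<in> H10 \<Omega>"
  by (simp add: H10_diff R_H10)

lemma residual_orthogonal:
  "w \<in> H10 \<Omega> \<Longrightarrow> v \<in> W \<Longrightarrow> grad_inner \<Omega> (\<lambda>x. w x - R w x) v = 0"
  using ritz by (simp add: is_ritz_projection_def)

lemma grad_inner_R:
  assumes "w \<in> H10 \<Omega>" "v \<in> W"
  shows "grad_inner \<Omega> (R w) v = grad_inner \<Omega> w v"
proof -
  have "v \<in> H10 \<Omega>" using assms(2) span_H10 by blast
  with residual_orthogonal[OF assms] grad_inner_diff[of w "R w" v] assms(1) show ?thesis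
    by (simp add: H10_H1 R_H10)
qed

text \<open>
  The residual of \<open>w\<close> is linear in \<open>w\<close> up to null sets, although \<open>R\<close> is only a choice of
  representatives: the difference of the two sides lies in \<open>W\<close> and its gradient is orthogonal to the
  gradients of all members of \<open>W\<close>, hence to itself; by definiteness it vanishes.
\<close>

lemma residual_combination:
  assumes w: "w \<in> H10 \<Omega>" and p: "\<And>i. i \<in> J \<Longrightarrow> p i \<in> H10 \<Omega>"
    and expansion: "AE x in lebesgue_on \<Omega>. w x = (\<Sum>i\<in>J. c i * p i x)"
  shows "AE x in lebesgue_on \<Omega>. w x - R w x = (\<Sum>i\<in>J. c i * (p i x - R (p i) x))"
proof -
  let ?Rp = "\<lambda>x. \<Sum>i\<in>J. c i * R (p i) x" and ?p = "\<lambda>x. \<Sum>i\<in>J. c i * p i x"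
  have Rp: "?Rp \<in> W" by (intro fun_span_sum R_in_W p)
  have d: "(\<lambda>x. ?Rp x - R w x) \<in> W" (is "?d \<in> W") by (rule fun_span_diff[OF Rp R_in_W[OF w]])
  then have dH: "?d \<in> H10 \<Omega>" using span_H10 by blast
  have RpH: "?Rp \<in> H10 \<Omega>" using Rp span_H10 by blast
  have "grad_inner \<Omega> ?d ?d = grad_inner \<Omega> ?Rp ?d - grad_inner \<Omega> (R w) ?d"
    by (rule grad_inner_diff[OF RpH[THEN H10_H1] R_H10[OF w, THEN H10_H1] dH[THEN H10_H1]])
  also have "grad_inner \<Omega> ?Rp ?d = (\<Sum>i\<in>J. c i * grad_inner \<Omega> (R (p i)) ?d)"
    by (rule grad_inner_sum[OF dH R_H10[OF p]])
  also have "\<dots> = (\<Sum>i\<in>J. c i * grad_inner \<Omega> (p i) ?d)"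
    using p d by (intro sum.cong refl) (simp add: grad_inner_R)
  also have "\<dots> = grad_inner \<Omega> ?p ?d"
    by (rule grad_inner_sum[OF dH p, symmetric])
  also have "\<dots> = grad_inner \<Omega> w ?d"
    by (rule grad_inner_cong_AE[OF H10_L2[OF w] H10_L2[OF H10_sum[OF p]] expansion, symmetric])
  also have "grad_inner \<Omega> (R w) ?d = grad_inner \<Omega> w ?d" by (rule grad_inner_R[OF w d])
  finally have "grad_inner \<Omega> ?d ?d = 0" by simp
  from H10_eq_0_if_gradient_eq_0[OF dH this] expansion show ?thesis
    by eventually_elim (simp add: sum_subtractf right_diff_distrib)
qed

lemma residual_of_W:
  assumes "w \<in> W"
  shows "L2_norm \<Omega> (\<lambda>x. w x - R w x) = 0"
proof -
  have w: "w \<in> H10 \<Omega>" using assms span_H10 by blast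
  have d: "(\<lambda>x. w x - R w x) \<in> W" by (rule fun_span_diff[OF assms R_in_W[OF w]])
  have "AE x in lebesgue_on \<Omega>. w x - R w x = 0"
    by (rule H10_eq_0_if_gradient_eq_0[OF residual_H10[OF w] residual_orthogonal[OF w d]])
  from L2_norm_cong_AE[OF this fun_span_L2[OF d] L2_zero] show ?thesis
    by (simp add: L2_norm_def L2_inner_def)
qed

lemma residual_diff_quot:
  assumes "u (n + 1) \<in> H10 \<Omega>" "u n \<in> H10 \<Omega>"
  shows "diff_quot T N u n \<in> H10 \<Omega>"
    and "AE x in lebesgue_on \<Omega>. diff_quot T N u n x - R (diff_quot T N u n) x
      = diff_quot T N (\<lambda>k x. u k x - R (u k) x) n x"
proof -
  let ?c = "\<lambda>k. if k = n then - 1 / time_step T N else 1 / time_step T N"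
  have sum: "diff_quot T N z n = (\<lambda>x. \<Sum>k\<in>{n, n + 1}. ?c k * z k x)" for z :: "nat \<Rightarrow> real ^ 'd \<Rightarrow> real"
    unfolding diff_quot_eq_lincomb by (simp add: add.commute)
  have p: "u k \<in> H10 \<Omega>" if "k \<in> {n, n + 1}" for k using that assms by auto
  show dq: "diff_quot T N u n \<in> H10 \<Omega>" unfolding sum by (rule H10_sum[OF p])
  have "AE x in lebesgue_on \<Omega>. diff_quot T N u n x = (\<Sum>k\<in>{n, n + 1}. ?c k * u k x)"
    unfolding sum by simp
  from residual_combination[OF dq p this]
  show "AE x in lebesgue_on \<Omega>. diff_quot T N u n x - R (diff_quot T N u n) x
      = diff_quot T N (\<lambda>k x. u k x - R (u k) x) n x"
    unfolding sum[of "\<lambda>k x. u k x - R (u k) x"] .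
qed

end

lemma snapshot_Suc: "n \<ge> 1 \<Longrightarrow> snapshot T N u (n + 1) = diff_quot T N u n"
  by (simp add: snapshot_def)

lemma snapshot_1: "snapshot T N u 1 = u 1"
  by (simp add: snapshot_def)

context ritz_projection
begin

lemma snapshot_H10:
  assumes "\<And>n. n \<in> {1..N} \<Longrightarrow> u n \<in> H10 \<Omega>" "j \<in> {1..N}"
  shows "snapshot T N u j \<in> H10 \<Omega>"
proof (cases "j = 1")
  case True
  then show ?thesis using assms by (simp add: snapshot_def)
next
  case False
  with assms(2) obtain n where n: "j = n + 1" "n \<ge> 1"
    by (intro that[of "j - 1"]) auto
  have "diff_quot T N u n \<in> H10 \<Omega>"
    using n assms(2) by (intro residual_diff_quot(1) assms(1)) auto
  then show ?thesis unfolding n(1) snapshot_Suc[OF n(2)] .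
qed

text \<open>
  A mode with positive eigenvalue is \<open>K1\<close> of its right singular vector divided by the singular value,
  and so a combination of snapshots.
\<close>

lemma pod_mode_H10:
  assumes svd: "is_pod_svd \<Omega> T N u ev F \<phi>" and N: "N \<ge> 1"
    and u: "\<And>n. n \<in> {1..N} \<Longrightarrow> u n \<in> H10 \<Omega>" and i: "i \<in> {1..num_positive ev}"
  shows "\<phi> i \<in> H10 \<Omega>"
proof -
  have "i \<in> {i. i \<ge> 1 \<and> ev i > 0}" using i pod_svd_positive_indices(1)[OF svd] by simp
  then have pos: "ev i > 0" by simp
  have iN: "i \<in> {1..N}" using i pod_svd_positive_indices(2)[OF svd] by simp
  let ?s = "\<lambda>x. \<Sum>j = 1..N. (S_weight T N j * F i j / sqrt (ev i)) * snapshot T N u j x"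
  have "AE x in lebesgue_on \<Omega>. ?s x = \<phi> i x"
    using pod_svd_K1[OF svd iN]
  proof eventually_elim
    case (elim x)
    have "?s x = K1 T N u (F i) x / sqrt (ev i)"
      unfolding K1_eq_sum[OF N] by (simp add: sum_divide_distrib)
    then show ?case using elim pos by simp
  qed
  then show ?thesis
    by (rule H10_cong_AE[OF H10_sum[OF snapshot_H10[OF u]], rotated -1])
       (use i pod_svd_L2[OF svd] in auto)
qed

text \<open>
  The residuals of the snapshots have the same coefficients with respect to \<open>\<phi>\<^sub>i - R \<phi>\<^sub>i\<close> as the
  snapshots with respect to \<open>\<phi>\<^sub>i\<close>. The residuals \<open>\<phi>\<^sub>i - R \<phi>\<^sub>i\<close> need not be orthogonal, but the
  coefficient vectors are orthogonal in \<open>S\<close>, and this is enough to remove the cross terms.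
\<close>

lemma pod_residual_identity:
  assumes svd: "is_pod_svd \<Omega> T N u ev F \<phi>" and T: "T > 0" and N: "N \<ge> 2"
    and u: "\<And>n. n \<in> {1..N} \<Longrightarrow> u n \<in> H10 \<Omega>"
  defines "\<eta> \<equiv> \<lambda>n x. u n x - R (u n) x"
  shows "(L2_norm \<Omega> (\<eta> 1))\<^sup>2 + time_step T N * (\<Sum>n = 1..<N. (L2_norm \<Omega> (diff_quot T N \<eta> n))\<^sup>2)
    = (\<Sum>i = 1..num_positive ev. ev i * (L2_norm \<Omega> (\<lambda>x. \<phi> i x - R (\<phi> i) x))\<^sup>2)"
proof -
  define \<rho> where "\<rho> j = (\<lambda>x. snapshot T N u j x - R (snapshot T N u j) x)" for j
  let ?s = "num_positive ev"
  have N1: "N \<ge> 1" using N by simp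
  note sN = pod_svd_positive_indices(2)[OF svd]
  note mode = pod_mode_H10[OF svd N1 u]
  note snap = snapshot_H10[OF u]
  have \<rho>H: "\<rho> j \<in> H10 \<Omega>" if "j \<in> {1..N}" for j
    unfolding \<rho>_def by (rule residual_H10[OF snap[OF _ that]])
  have \<eta>H: "\<eta> n \<in> H10 \<Omega>" if "n \<in> {1..N}" for n
    unfolding \<eta>_def by (rule residual_H10[OF u[OF that]])
  have "(\<Sum>j\<in>{1..N}. S_weight T N j * (L2_norm \<Omega> (\<rho> j))\<^sup>2)
      = (\<Sum>i\<in>{1..?s}. (sqrt (ev i))\<^sup>2 * (L2_norm \<Omega> (\<lambda>x. \<phi> i x - R (\<phi> i) x))\<^sup>2)"
  proof (rule weighted_energy_of_orthonormal_combination[where F = F])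
    show "(\<lambda>x. \<phi> i x - R (\<phi> i) x) \<in> L2 \<Omega>" if "i \<in> {1..?s}" for i
      by (rule H10_L2[OF residual_H10[OF mode[OF _ that]]])
    show "\<rho> j \<in> L2 \<Omega>" if "j \<in> {1..N}" for j by (rule H10_L2[OF \<rho>H[OF that]])
    show "AE x in lebesgue_on \<Omega>.
        \<rho> j x = (\<Sum>i\<in>{1..?s}. (sqrt (ev i) * F i j) * (\<phi> i x - R (\<phi> i) x))" if "j \<in> {1..N}" for j
      unfolding \<rho>_def
      by (rule residual_combination[OF snap[OF _ that] mode snapshot_pod_expansion[OF svd T N that]])
    show "(\<Sum>j\<in>{1..N}. S_weight T N j * F i j * F l j) = (if i = l then 1 else 0)"
      if "i \<in> {1..?s}" "l \<in> {1..?s}" for i l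
      by (rule pod_svd_orthonormal[OF svd N1]) (use that sN in auto)
  qed simp
  also have "\<dots> = (\<Sum>i = 1..?s. ev i * (L2_norm \<Omega> (\<lambda>x. \<phi> i x - R (\<phi> i) x))\<^sup>2)"
    by (intro sum.cong refl) (simp add: pod_svd_nonneg[OF svd])
  also have "(\<Sum>j\<in>{1..N}. S_weight T N j * (L2_norm \<Omega> (\<rho> j))\<^sup>2)
      = (L2_norm \<Omega> (\<rho> 1))\<^sup>2 + (\<Sum>j = 2..N. S_weight T N j * (L2_norm \<Omega> (\<rho> j))\<^sup>2)"
    unfolding sum_split_first[OF N1] by (simp add: S_weight_def)
  also have "\<rho> 1 = \<eta> 1" unfolding \<rho>_def \<eta>_def snapshot_1 ..
  also have "(\<Sum>j = 2..N. S_weight T N j * (L2_norm \<Omega> (\<rho> j))\<^sup>2)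
      = (\<Sum>n = 1..<N. time_step T N * (L2_norm \<Omega> (diff_quot T N \<eta> n))\<^sup>2)"
  proof (rule sum.reindex_bij_witness[of _ "\<lambda>n. n + 1" "\<lambda>j. j - 1"])
    fix j assume j: "j \<in> {2..N}"
    then obtain n where n: "j = n + 1" "n \<in> {1..<N}" by (intro that[of "j - 1"]) auto
    have un: "u (n + 1) \<in> H10 \<Omega>" "u n \<in> H10 \<Omega>" using n by (auto intro: u)
    have "L2_norm \<Omega> (\<rho> j) = L2_norm \<Omega> (diff_quot T N \<eta> n)"
    proof (rule L2_norm_cong_AE)
      show "AE x in lebesgue_on \<Omega>. \<rho> j x = diff_quot T N \<eta> n x"
        using residual_diff_quot(2)[OF un, of T N] n by (simp add: \<rho>_def \<eta>_def snapshot_def)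
      show "\<rho> j \<in> L2 \<Omega>" using j by (intro H10_L2 \<rho>H) simp
      show "diff_quot T N \<eta> n \<in> L2 \<Omega>" using n by (intro diff_quot_L2 H10_L2 \<eta>H) auto
    qed
    then show "time_step T N * (L2_norm \<Omega> (diff_quot T N \<eta> (j - 1)))\<^sup>2
        = S_weight T N j * (L2_norm \<Omega> (\<rho> j))\<^sup>2"
      using n by (simp add: S_weight_def)
  qed auto
  finally show ?thesis by (simp add: sum_distrib_left)
qed

section \<open>The error of the reduced-order model\<close>

text \<open>
  Testing the difference of the schemes with \<open>\<theta>\<^bsup>n+1\<^esup>\<close> gives the energy equation
  \<open>\<parallel>\<theta>\<^bsup>n+1\<^esup>\<parallel>\<^sup>2 + \<Delta>t \<nu> \<parallel>\<nabla>\<theta>\<^bsup>n+1\<^esup>\<parallel>\<^sup>2 = (\<theta>\<^sup>n, \<theta>\<^bsup>n+1\<^esup>) + \<Delta>t (\<partial>\<eta>\<^sup>n, \<theta>\<^bsup>n+1\<^esup>)\<close>. Dropping the gradient and dividing by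
  \<open>\<parallel>\<theta>\<^bsup>n+1\<^esup>\<parallel>\<close> leaves a recursion with factor \<open>1\<close>, in which the increments simply add up.
\<close>

lemma rom_error_step:
  assumes u: "backward_euler \<Omega> \<nu> T f N Vh u" and ur: "backward_euler \<Omega> \<nu> T f N W ur"
    and sub: "W \<subseteq> Vh" "Vh \<subseteq> H10 \<Omega>" and \<nu>: "\<nu> \<ge> 0" and \<tau>: "time_step T N > 0" and n: "n \<in> {1..<N}"
  defines "\<eta> \<equiv> \<lambda>n x. u n x - R (u n) x" and "\<theta> \<equiv> \<lambda>n x. ur n x - R (u n) x"
  shows "L2_norm \<Omega> (\<theta> (n + 1))
    \<le> L2_norm \<Omega> (\<theta> n) + time_step T N * L2_norm \<Omega> (diff_quot T N \<eta> n)"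
proof -
  let ?\<tau> = "time_step T N" and ?v = "\<theta> (n + 1)" and ?\<delta> = "diff_quot T N \<eta> n"
  have k: "k \<in> {1..N}" if "k \<in> {n, n + 1}" for k using that n by auto
  have uH: "u k \<in> H10 \<Omega>" if "k \<in> {n, n + 1}" for k
    using u sub k[OF that] by (auto simp: backward_euler_def)
  have urW: "ur k \<in> W" if "k \<in> {n, n + 1}" for k
    using ur k[OF that] by (auto simp: backward_euler_def)
  have RuW: "R (u k) \<in> W" if "k \<in> {n, n + 1}" for k by (rule R_in_W[OF uH[OF that]])
  have \<theta>W: "\<theta> k \<in> W" if "k \<in> {n, n + 1}" for k
    unfolding \<theta>_def by (rule fun_span_diff[OF urW[OF that] RuW[OF that]])
  have v: "?v \<in> W" by (rule \<theta>W) simp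
  have vL: "?v \<in> L2 \<Omega>" by (rule fun_span_L2[OF v])
  have WH: "w \<in> W \<Longrightarrow> w \<in> H1 \<Omega>" for w using span_H10 H10_H1 by blast
  have eq_u: "L2_inner \<Omega> (diff_quot T N u n) ?v + \<nu> * grad_inner \<Omega> (u (n + 1)) ?v
      = L2_inner \<Omega> (f (grid_time T N (n + 1))) ?v"
    using u n v sub(1) unfolding backward_euler_def by blast
  have eq_ur: "L2_inner \<Omega> (diff_quot T N ur n) ?v + \<nu> * grad_inner \<Omega> (ur (n + 1)) ?v
      = L2_inner \<Omega> (f (grid_time T N (n + 1))) ?v"
    using ur n v unfolding backward_euler_def by blast
  have grad_v: "grad_inner \<Omega> ?v ?v = grad_inner \<Omega> (ur (n + 1)) ?v - grad_inner \<Omega> (u (n + 1)) ?v"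
  proof -
    have "grad_inner \<Omega> ?v ?v = grad_inner \<Omega> (ur (n + 1)) ?v - grad_inner \<Omega> (R (u (n + 1))) ?v"
      using grad_inner_diff[OF WH[OF urW[of "n + 1"]] WH[OF RuW[of "n + 1"]] WH[OF v]]
      by (simp add: \<theta>_def)
    then show ?thesis using grad_inner_R[OF uH[of "n + 1"] v] by simp
  qed
  have inner_\<eta>: "L2_inner \<Omega> (\<eta> k) ?v = L2_inner \<Omega> (u k) ?v - L2_inner \<Omega> (R (u k)) ?v"
    if "k \<in> {n, n + 1}" for k
    unfolding \<eta>_def by (rule L2_inner_diff[OF H10_L2[OF uH[OF that]] fun_span_L2[OF RuW[OF that]] vL])
  have inner_\<theta>: "L2_inner \<Omega> (\<theta> k) ?v = L2_inner \<Omega> (ur k) ?v - L2_inner \<Omega> (R (u k)) ?v"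
    if "k \<in> {n, n + 1}" for k
    using L2_inner_diff[OF fun_span_L2[OF urW[OF that]] fun_span_L2[OF RuW[OF that]] vL]
    by (simp add: \<theta>_def)
  have \<eta>L: "\<eta> k \<in> L2 \<Omega>" if "k \<in> {n, n + 1}" for k
    unfolding \<eta>_def by (rule H10_L2[OF residual_H10[OF uH[OF that]]])
  have dq: "?\<tau> * L2_inner \<Omega> (diff_quot T N z n) ?v = L2_inner \<Omega> (z (n + 1)) ?v - L2_inner \<Omega> (z n) ?v"
    if "\<And>k. k \<in> {n, n + 1} \<Longrightarrow> z k \<in> L2 \<Omega>" for z
    using L2_inner_diff_quot[OF that[of "n + 1"] that[of n] vL, of T N] \<tau> by simp
  have "L2_inner \<Omega> (diff_quot T N ur n) ?v + \<nu> * grad_inner \<Omega> ?v ?v = L2_inner \<Omega> (diff_quot T N u n) ?v"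
    using eq_u eq_ur unfolding grad_v right_diff_distrib by linarith
  then have "?\<tau> * (L2_inner \<Omega> (diff_quot T N ur n) ?v + \<nu> * grad_inner \<Omega> ?v ?v)
      = ?\<tau> * L2_inner \<Omega> (diff_quot T N u n) ?v" by simp
  then have scaled: "?\<tau> * L2_inner \<Omega> (diff_quot T N ur n) ?v + ?\<tau> * \<nu> * grad_inner \<Omega> ?v ?v
      = ?\<tau> * L2_inner \<Omega> (diff_quot T N u n) ?v" by (simp add: distrib_left)
  have energy: "L2_inner \<Omega> ?v ?v + ?\<tau> * \<nu> * grad_inner \<Omega> ?v ?v
      = L2_inner \<Omega> (\<theta> n) ?v + ?\<tau> * L2_inner \<Omega> ?\<delta> ?v"
    using scaled dq[OF fun_span_L2[OF urW]] dq[OF H10_L2[OF uH]] dq[OF \<eta>L]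
      inner_\<eta>[of n] inner_\<eta>[of "n + 1"] inner_\<theta>[of n] inner_\<theta>[of "n + 1"]
    by simp
  have "(L2_norm \<Omega> ?v)\<^sup>2 \<le> L2_inner \<Omega> (\<theta> n) ?v + ?\<tau> * L2_inner \<Omega> ?\<delta> ?v"
  proof -
    have "0 \<le> ?\<tau> * \<nu> * grad_inner \<Omega> ?v ?v"
      using \<tau> \<nu> by (intro mult_nonneg_nonneg grad_inner_self_nonneg) simp_all
    then show ?thesis using energy by (simp add: L2_norm_square)
  qed
  also have "\<dots> \<le> L2_norm \<Omega> (\<theta> n) * L2_norm \<Omega> ?v + ?\<tau> * (L2_norm \<Omega> ?\<delta> * L2_norm \<Omega> ?v)"
  proof (intro add_mono mult_left_mono)
    show "L2_inner \<Omega> (\<theta> n) ?v \<le> L2_norm \<Omega> (\<theta> n) * L2_norm \<Omega> ?v"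
      using L2_inner_le_norm[OF fun_span_L2[OF \<theta>W[of n]] vL] by simp
    have "?\<delta> \<in> L2 \<Omega>" by (rule diff_quot_L2; rule \<eta>L; simp)
    from L2_inner_le_norm[OF this vL]
    show "L2_inner \<Omega> ?\<delta> ?v \<le> L2_norm \<Omega> ?\<delta> * L2_norm \<Omega> ?v" by simp
  qed (use \<tau> in simp)
  finally have "L2_norm \<Omega> ?v * L2_norm \<Omega> ?v
      \<le> (L2_norm \<Omega> (\<theta> n) + ?\<tau> * L2_norm \<Omega> ?\<delta>) * L2_norm \<Omega> ?v"
    by (simp add: power2_eq_square algebra_simps)
  then show ?thesis
  proof (cases "L2_norm \<Omega> ?v = 0")
    case True
    then show ?thesis using \<tau> by (simp add: add_nonneg_nonneg)
  next
    case False
    then have "L2_norm \<Omega> ?v > 0" using L2_norm_nonneg[of \<Omega> ?v] by linarith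
    with \<open>L2_norm \<Omega> ?v * L2_norm \<Omega> ?v \<le> _\<close> show ?thesis by simp
  qed
qed

lemma residual_growth_step:
  assumes "\<eta> (n + 1) \<in> L2 \<Omega>" "\<eta> n \<in> L2 \<Omega>" "time_step T N > 0"
  shows "L2_norm \<Omega> (\<eta> (n + 1)) \<le> L2_norm \<Omega> (\<eta> n) + time_step T N * L2_norm \<Omega> (diff_quot T N \<eta> n)"
proof -
  have "\<eta> (n + 1) = (\<lambda>x. \<eta> n x + time_step T N * diff_quot T N \<eta> n x)"
    using assms(3) by (simp add: diff_quot_def)
  then show ?thesis
    using L2_norm_lincomb_le[OF assms(2) diff_quot_L2[OF assms(1,2)], of "time_step T N" T N] assms(3)
    by simp
qed

end

lemma sum_power2_le_card_mult:
  fixes d :: "nat \<Rightarrow> real"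
  assumes "N \<ge> 1"
  shows "(\<Sum>n = 1..<N. d n)\<^sup>2 \<le> (real N - 1) * (\<Sum>n = 1..<N. (d n)\<^sup>2)"
  using sum_squared_le_sum_of_squares[of d "{1..<N}"] assms by (simp add: of_nat_diff mult.commute)

lemma incremental_bound:
  fixes x d :: "nat \<Rightarrow> real"
  assumes step: "\<And>n. n \<in> {1..<N} \<Longrightarrow> x (n + 1) \<le> x n + \<tau> * d n"
    and d: "\<And>n. d n \<ge> 0" and \<tau>: "\<tau> \<ge> 0" and k: "k \<in> {1..N}"
  shows "x k \<le> x 1 + \<tau> * (\<Sum>n = 1..<N. d n)"
proof -
  have "x k \<le> x 1 + \<tau> * (\<Sum>n = 1..<k. d n)" if "k \<ge> 1" "k \<le> N" for k
    using that
  proof (induction k rule: nat_induct_at_least)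
    case base
    then show ?case by simp
  next
    case (Suc k)
    then show ?case using step[of k] by (simp add: distrib_left)
  qed
  moreover have "(\<Sum>n = 1..<k. d n) \<le> (\<Sum>n = 1..<N. d n)"
    using k d by (intro sum_mono2) auto
  ultimately show ?thesis using k \<tau> mult_left_mono[OF _ \<tau>] by (smt (verit) atLeastAtMost_iff)
qed

lemma power2_sum3_le: "(a + b + c)\<^sup>2 \<le> 3 * (a\<^sup>2 + b\<^sup>2 + c\<^sup>2)" for a b c :: real
proof -
  have "0 \<le> (a - b)\<^sup>2 + (b - c)\<^sup>2 + (a - c)\<^sup>2" by simp
  then show ?thesis by (simp add: power2_eq_square algebra_simps)
qed

theorem theorem4p2:
  fixes \<Omega> :: "(real ^ 'd) set"
    and \<nu> T :: real
    and f :: "real \<Rightarrow> real ^ 'd \<Rightarrow> real"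
  assumes "bounded_lipschitz_domain \<Omega>"
    and "\<nu> > 0"
    and "T > 0"
    and "\<And>t. t \<in> {0..T} \<Longrightarrow> f t \<in> L2 \<Omega>"
  shows "\<exists>C > 0. \<forall>(N :: nat) (r :: nat) (Vh :: (real ^ 'd \<Rightarrow> real) set)
      (u :: nat \<Rightarrow> real ^ 'd \<Rightarrow> real) (ur :: nat \<Rightarrow> real ^ 'd \<Rightarrow> real)
      (ev :: nat \<Rightarrow> real) (F :: nat \<Rightarrow> nat \<Rightarrow> real) (\<phi> :: nat \<Rightarrow> real ^ 'd \<Rightarrow> real)
      (R :: (real ^ 'd \<Rightarrow> real) \<Rightarrow> (real ^ 'd \<Rightarrow> real)).
    N \<ge> 2 \<and> conforming_space \<Omega> Vh \<and> backward_euler \<Omega> \<nu> T f N Vh u \<and>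
    is_pod_svd \<Omega> T N u ev F \<phi> \<and>
    r \<ge> 1 \<and> (\<forall>i \<in> {1..r}. \<phi> i \<in> Vh) \<and>
    is_ritz_projection \<Omega> (fun_span \<Omega> {1..r} \<phi>) R \<and>
    backward_euler \<Omega> \<nu> T f N (fun_span \<Omega> {1..r} \<phi>) ur \<and>
    is_L2_projection \<Omega> (fun_span \<Omega> {1..r} \<phi>) (u 1) (ur 1)
    \<longrightarrow>
    (MAX k \<in> {1..N}. (L2_norm \<Omega> (\<lambda>x. u k x - ur k x))\<^sup>2)
      \<le> C * ((\<Sum>i = r + 1..num_positive ev. ev i * (L2_norm \<Omega> (\<lambda>x. \<phi> i x - R (\<phi> i) x))\<^sup>2)
              + (L2_norm \<Omega> (\<lambda>x. ur 1 x - R (u 1) x))\<^sup>2)"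
proof (intro exI[of _ "3 * (1 + 4 * T)"] conjI allI impI)
  show "3 * (1 + 4 * T) > 0" using \<open>T > 0\<close> by simp
next
  fix N r :: nat and Vh :: "(real ^ 'd \<Rightarrow> real) set" and u ur :: "nat \<Rightarrow> real ^ 'd \<Rightarrow> real"
    and ev :: "nat \<Rightarrow> real" and F :: "nat \<Rightarrow> nat \<Rightarrow> real" and \<phi> :: "nat \<Rightarrow> real ^ 'd \<Rightarrow> real"
    and R :: "(real ^ 'd \<Rightarrow> real) \<Rightarrow> (real ^ 'd \<Rightarrow> real)"
  let ?W = "fun_span \<Omega> {1..r} \<phi>"
  assume "N \<ge> 2 \<and> conforming_space \<Omega> Vh \<and> backward_euler \<Omega> \<nu> T f N Vh u \<and>
    is_pod_svd \<Omega> T N u ev F \<phi> \<and>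
    r \<ge> 1 \<and> (\<forall>i \<in> {1..r}. \<phi> i \<in> Vh) \<and>
    is_ritz_projection \<Omega> ?W R \<and>
    backward_euler \<Omega> \<nu> T f N ?W ur \<and>
    is_L2_projection \<Omega> ?W (u 1) (ur 1)"
  then have N: "N \<ge> 2" and Vh: "conforming_space \<Omega> Vh" and u: "backward_euler \<Omega> \<nu> T f N Vh u"
    and svd: "is_pod_svd \<Omega> T N u ev F \<phi>" and modes: "\<And>i. i \<in> {1..r} \<Longrightarrow> \<phi> i \<in> Vh"
    and ritz: "is_ritz_projection \<Omega> ?W R" and ur: "backward_euler \<Omega> \<nu> T f N ?W ur"
    by blast+
  interpret bounded_open_set \<Omega>
    using assms(1) by unfold_locales (auto simp: bounded_lipschitz_domain_def)
  have VhH: "Vh \<subseteq> H10 \<Omega>" by (rule conforming_space_subset_H10[OF Vh])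
  have WVh: "?W \<subseteq> Vh"
  proof -
    obtain m b where "Vh = fun_span \<Omega> {1..m} b" using Vh unfolding conforming_space_def by blast
    then show ?thesis using fun_span_subset[of "{1..r}" \<phi> \<Omega> "{1..m}" b] modes by simp
  qed
  interpret ritz_projection \<Omega> "{1..r}" \<phi> R
    using ritz WVh VhH by unfold_locales auto
  define \<tau> where "\<tau> = time_step T N"
  define \<eta> where "\<eta> = (\<lambda>n x. u n x - R (u n) x)"
  define \<theta> where "\<theta> = (\<lambda>n x. ur n x - R (u n) x)"
  define d where "d n = L2_norm \<Omega> (diff_quot T N \<eta> n)" for n
  define E where "E = (\<Sum>i = r + 1..num_positive ev. ev i * (L2_norm \<Omega> (\<lambda>x. \<phi> i x - R (\<phi> i) x))\<^sup>2)"
  have \<tau>: "\<tau> > 0" unfolding \<tau>_def by (rule time_step_pos[OF \<open>T > 0\<close> N])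
  have uH: "u n \<in> H10 \<Omega>" if "n \<in> {1..N}" for n
    using u VhH that by (auto simp: backward_euler_def)
  have \<eta>L: "\<eta> n \<in> L2 \<Omega>" if "n \<in> {1..N}" for n
    unfolding \<eta>_def by (rule H10_L2[OF residual_H10[OF uH[OF that]]])
  have \<theta>L: "\<theta> n \<in> L2 \<Omega>" if "n \<in> {1..N}" for n
    using ur that uH[OF that] unfolding \<theta>_def
    by (intro L2_diff fun_span_L2[of _ _ "{1..r}" \<phi>] R_in_W) (auto simp: backward_euler_def)
  have energy: "(L2_norm \<Omega> (\<eta> 1))\<^sup>2 + \<tau> * (\<Sum>n = 1..<N. (d n)\<^sup>2) = E"
  proof -
    have "(L2_norm \<Omega> (\<eta> 1))\<^sup>2 + \<tau> * (\<Sum>n = 1..<N. (d n)\<^sup>2)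
        = (\<Sum>i = 1..num_positive ev. ev i * (L2_norm \<Omega> (\<lambda>x. \<phi> i x - R (\<phi> i) x))\<^sup>2)"
      unfolding d_def \<tau>_def \<eta>_def by (rule pod_residual_identity[OF svd \<open>T > 0\<close> N uH])
    also have "\<dots> = E"
    proof -
      have "L2_norm \<Omega> (\<lambda>x. \<phi> i x - R (\<phi> i) x) = 0" if "i \<in> {1..r}" for i
        using that pod_svd_L2[OF svd] by (intro residual_of_W fun_span_basis) auto
      then show ?thesis unfolding E_def
        by (intro sum.mono_neutral_right) auto
    qed
    finally show ?thesis .
  qed
  \<comment> \<open>The total increment, common to both recursions.\<close>
  define D where "D = \<tau> * (\<Sum>n = 1..<N. d n)"
  have D: "D\<^sup>2 \<le> T * E"
  proof -
    have "D\<^sup>2 \<le> \<tau>\<^sup>2 * ((real N - 1) * (\<Sum>n = 1..<N. (d n)\<^sup>2))"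
      unfolding D_def power_mult_distrib
      using N by (intro mult_left_mono sum_power2_le_card_mult) simp_all
    also have "\<dots> = (\<tau> * (real N - 1)) * (\<tau> * (\<Sum>n = 1..<N. (d n)\<^sup>2))"
      by (simp add: power2_eq_square)
    also have "\<tau> * (real N - 1) = T" using N by (simp add: \<tau>_def time_step_def)
    also have "T * (\<tau> * (\<Sum>n = 1..<N. (d n)\<^sup>2)) \<le> T * E"
      using energy \<open>T > 0\<close> by (intro mult_left_mono) auto
    finally show ?thesis .
  qed
  have bound: "(L2_norm \<Omega> (\<lambda>x. u k x - ur k x))\<^sup>2
      \<le> 3 * (1 + 4 * T) * (E + (L2_norm \<Omega> (\<theta> 1))\<^sup>2)" if k: "k \<in> {1..N}" for k
  proof -
    have "L2_norm \<Omega> (\<lambda>x. u k x - ur k x) = L2_norm \<Omega> (\<lambda>x. \<eta> k x - \<theta> k x)"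
      by (simp add: \<eta>_def \<theta>_def)
    also have "\<dots> \<le> L2_norm \<Omega> (\<eta> k) + L2_norm \<Omega> (\<theta> k)"
      by (rule L2_norm_diff_le[OF \<eta>L[OF k] \<theta>L[OF k]])
    also have "L2_norm \<Omega> (\<eta> k) \<le> L2_norm \<Omega> (\<eta> 1) + D"
      unfolding D_def
    proof (rule incremental_bound[OF _ _ _ k])
      show "L2_norm \<Omega> (\<eta> (n + 1)) \<le> L2_norm \<Omega> (\<eta> n) + \<tau> * d n" if "n \<in> {1..<N}" for n
        unfolding \<tau>_def d_def
        using that \<tau> by (intro residual_growth_step \<eta>L) (auto simp: \<tau>_def)
    qed (use \<tau> in \<open>auto simp: d_def\<close>)
    also have "L2_norm \<Omega> (\<theta> k) \<le> L2_norm \<Omega> (\<theta> 1) + D"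
      unfolding D_def
    proof (rule incremental_bound[OF _ _ _ k])
      show "L2_norm \<Omega> (\<theta> (n + 1)) \<le> L2_norm \<Omega> (\<theta> n) + \<tau> * d n" if "n \<in> {1..<N}" for n
        using rom_error_step[OF u ur WVh VhH _ _ that] \<tau> \<open>\<nu> > 0\<close>
        by (simp add: \<tau>_def d_def \<theta>_def \<eta>_def)
    qed (use \<tau> in \<open>auto simp: d_def\<close>)
    finally have "L2_norm \<Omega> (\<lambda>x. u k x - ur k x)
        \<le> L2_norm \<Omega> (\<eta> 1) + 2 * D + L2_norm \<Omega> (\<theta> 1)" by simp
    then have "(L2_norm \<Omega> (\<lambda>x. u k x - ur k x))\<^sup>2
        \<le> (L2_norm \<Omega> (\<eta> 1) + 2 * D + L2_norm \<Omega> (\<theta> 1))\<^sup>2"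
      by (rule power_mono) simp
    also have "\<dots> \<le> 3 * ((L2_norm \<Omega> (\<eta> 1))\<^sup>2 + (2 * D)\<^sup>2 + (L2_norm \<Omega> (\<theta> 1))\<^sup>2)"
      by (rule power2_sum3_le)
    also have "\<dots> \<le> 3 * (E + 4 * (T * E) + (L2_norm \<Omega> (\<theta> 1))\<^sup>2)"
    proof -
      have "(L2_norm \<Omega> (\<eta> 1))\<^sup>2 \<le> E"
        using energy \<tau> by (smt (verit) mult_nonneg_nonneg sum_nonneg zero_le_power2)
      then show ?thesis using D by (simp add: power_mult_distrib)
    qed
    also have "\<dots> \<le> 3 * (1 + 4 * T) * (E + (L2_norm \<Omega> (\<theta> 1))\<^sup>2)"
      using \<open>T > 0\<close> by (simp add: algebra_simps)
    finally show ?thesis .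
  qed
  show "(MAX k \<in> {1..N}. (L2_norm \<Omega> (\<lambda>x. u k x - ur k x))\<^sup>2)
      \<le> 3 * (1 + 4 * T) * ((\<Sum>i = r + 1..num_positive ev. ev i * (L2_norm \<Omega> (\<lambda>x. \<phi> i x - R (\<phi> i) x))\<^sup>2)
              + (L2_norm \<Omega> (\<lambda>x. ur 1 x - R (u 1) x))\<^sup>2)"
    using bound N by (subst Max_le_iff) (auto simp: E_def \<theta>_def)
qed

end
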